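(* Let $X_1, X_2, \dots$ be i.i.d. standard normal random variables, let $\mathbb{F}_n$ be the empirical cumulative distribution function of $X_1,\dots,X_n$, and let $\Phi$ be the cumulative distribution function of the standard normal distribution. Then $$\lim_{n\to+\infty}\frac{n}{\log\log n}\,\mathbb{E}\left(W_2^2(\mathbb{F}_n,\Phi)\right)=1,$$ $$\lim_{n\to+\infty}\sqrt{\frac{n}{\log\log n}}\;\mathbb{E}\left(W_2(\mathbb{F}_n,\Phi)\right)=1.$$
   Context: For cumulative distribution functions $F,G$ on $\mathbb{R}$ with finite second moment, $W_2$ denotes the quadratic Wasserstein distance, given by $W_2^2(F,G)=\int_0^1 |F^{-1}(u)-G^{-1}(u)|^2\,du$, where $F^{-1}(u)=\inf\{x: F(x)\geqslant u\}$ is the quantile function. The empirical c.d.f. is $\mathbb{F}_n(x)=\frac1n\sum_{i=1}^n 1_{\{X_i\leqslant x\}}$. *)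

theory Defs
  imports "HOL-Probability.Probability"
begin

(* Meant for 0 < u < 1: then the set is nonempty and bounded below for every c.d.f. F, so that
   Inf is the true infimum. Outside this range the value is irrelevant below. *)
definition quantile :: "(real \<Rightarrow> real) \<Rightarrow> real \<Rightarrow> real" where
  "quantile F u = Inf {x. u \<le> F x}"

(* For c.d.f.s with finite second moment the integrand is integrable, so the Lebesgue integral
   is the true value and not the default 0. *)
definition W2 :: "(real \<Rightarrow> real) \<Rightarrow> (real \<Rightarrow> real) \<Rightarrow> real" where
  "W2 F G = sqrt (LINT u:{0<..<1}|lborel. \<bar>quantile F u - quantile G u\<bar>\<^sup>2)"

definition empirical_cdf :: "(nat \<Rightarrow> 'a \<Rightarrow> real) \<Rightarrow> nat \<Rightarrow> 'a \<Rightarrow> real \<Rightarrow> real" where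
  "empirical_cdf X n \<omega> x = (1 / real n) * (\<Sum>i = 1..n. of_bool (X i \<omega> \<le> x))"

definition std_normal_cdf :: "real \<Rightarrow> real" where
  "std_normal_cdf = cdf (density lborel std_normal_density)"

end

theory Submission imports Defs "HOL-Real_Asymp.Real_Asymp" begin

text \<open>
  Let \<open>I = phi \<circ> Phi\<inverse>\<close>, so that \<open>I'' = - 1 / I\<close>. Pathwise, \<open>W2\<^sup>2 (F\<^sub>n, Phi)\<close> is twice the integral
  over \<open>x\<close> of the Bregman divergence \<open>D (x, q) = I p + I' p * (q - p) - I q\<close> of \<open>- I\<close>, where
  \<open>p = Phi x\<close> and \<open>q = F\<^sub>n x\<close>. Log-concavity of the Gaussian density gives
  \<open>\<bar>D - (q - p)\<^sup>2 / (2 phi x)\<bar> \<le> \<bar>q - p\<bar>\<^sup>3 / (2 phi x min (p, 1 - p))\<close>, which is sharp enough on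
  \<open>\<bar>x\<bar> \<le> sqrt (ln n) / 2\<close> and yields the main term
  \<open>J = \<integral> Phi (1 - Phi) / phi ~ ln (ln n)\<close> of \<open>n E W2\<^sup>2\<close>. Up to \<open>\<bar>x\<bar> = sqrt (2 ln n)\<close> the bound
  \<open>D \<le> (q - p)\<^sup>2 / phi x\<close> and beyond it \<open>E D \<le> phi x\<close> cost only \<open>O(1)\<close>.

  For \<open>E W2\<close> the upper bound is Jensen's inequality. For the lower bound, the weighted square integral
  \<open>Q\<close> of \<open>F\<^sub>n - Phi\<close> over the inner region satisfies \<open>E (n Q)\<^sup>2 \<le> J\<^sup>2 + 16 J + o(1)\<close>, hence concentrates,
  and \<open>E sqrt (n Q) ~ sqrt J\<close> follows from a quadratic minorant of the square root.
\<close>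

section \<open>The standard normal distribution\<close>

text \<open>The representation by \<open>bregman\<close> removes the quantiles: W2^2 becomes an
  integral over x of a function of F_n x alone. Expectation commutes with the integral, and only
  moments of centred binomial sums, up to mixed order four, are needed. The price is the weight 1 /
  phi, whose mass on [-s, s] is exp (s^2 / 2) up to powers of s and magnifies every error. After
  multiplication by n, the cubic error over [-s, s] is about exp (s^2) / sqrt n, which forces s^2 <
  (ln n) / 2. This costs nothing in the limit: Phi (1 - Phi) / phi behaves like 1 / |x|, so J cut at
  s is about 2 ln s, which is asymptotic to ln (ln n) when s is any constant multiple of sqrt (ln
  n). For the same reason the band up to sqrt (2 ln n), wider by a constant factor only, adds a
  bounded amount.

  The mean of W2 is not determined by that of W2^2. The missing direction rests on n Q having
  variance O(J) up to o(1), not J^2, because the covariance of F_n x and F_n y is at most the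
  smaller tail mass at either point.\<close>

abbreviation phi :: "real \<Rightarrow> real" where "phi \<equiv> std_normal_density"
abbreviation Phi :: "real \<Rightarrow> real" where "Phi \<equiv> std_normal_cdf"

lemma phi_pos: "0 < phi x"
  by (simp add: normal_density_pos)

lemma phi_minus: "phi (- x) = phi x"
  by (simp add: std_normal_density_def)

lemma DERIV_phi: "DERIV phi x :> - x * phi x"
  unfolding std_normal_density_def[abs_def]
  by (auto intro!: derivative_eq_intros simp: field_simps)

lemma phi_tendsto_0: "(phi \<longlongrightarrow> 0) at_top"
  unfolding std_normal_density_def[abs_def] by real_asymp

lemma phi_mono_abs: "\<bar>x\<bar> \<le> \<bar>y\<bar> \<Longrightarrow> phi y \<le> phi x"
  by (auto simp: std_normal_density_def divide_right_mono abs_le_square_iff)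

lemma cdf_distribution_std_normal: "cdf_distribution (density lborel phi)"
  unfolding cdf_distribution_def real_distribution_def real_distribution_axioms_def
  by (simp add: prob_space_normal_density)

interpretation std_normal: cdf_distribution "density lborel phi"
  rewrites "cdf (density lborel phi) = Phi"
  by (simp_all add: cdf_distribution_std_normal std_normal_cdf_def)

text \<open>\<open>Phi\<close> is given as the measure of half-lines, so near x it is rewritten as a
  constant plus an integral of the continuous density. The base point a only has to lie left of x,
  which makes x interior to \<open>{a..x+1}\<close>.\<close>

lemma DERIV_Phi: "DERIV Phi x :> phi x"
proof -
  define a where "a = x - 1"
  have cont: "continuous_on {a..x+1} phi"
    by (rule DERIV_continuous_on[OF DERIV_phi[THEN has_field_derivative_at_within]])
  have eq: "Phi y = Phi a + integral {a..y} phi" if y: "y \<in> {a..x+1}" for y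
  proof -
    have int: "integrable lborel (\<lambda>z. indicator {a..y} z *\<^sub>R phi z)"
      by (intro integrable_mult_indicator) auto
    have "ennreal (Phi y - Phi a) = emeasure (density lborel phi) {a<..y}"
      using y by (subst std_normal.emeasure_Ioc) (auto simp: std_normal_cdf_def)
    also have "\<dots> = (\<integral>\<^sup>+z. ennreal (indicator {a..y} z *\<^sub>R phi z) \<partial>lborel)"
      using AE_lborel_singleton[of a]
      by (subst emeasure_density) (auto intro!: nn_integral_cong_AE split: split_indicator)
    also have "\<dots> = ennreal (LBINT z:{a..y}. phi z)"
      unfolding set_lebesgue_integral_def by (intro nn_integral_eq_integral int) auto
    also have "(LBINT z:{a..y}. phi z) = integral {a..y} phi"
      using int by (intro set_borel_integral_eq_integral) (simp add: set_integrable_def)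
    finally have "ennreal (Phi y - Phi a) = ennreal (integral {a..y} phi)" .
    moreover have "Phi a \<le> Phi y"
      using y std_normal.mono by (auto simp: mono_def)
    moreover have "0 \<le> integral {a..y} phi"
      by (intro integral_nonneg integrable_continuous_real continuous_on_subset[OF cont]) (use y in auto)
    ultimately show ?thesis by simp
  qed
  have "((\<lambda>y. integral {a..y} phi) has_vector_derivative phi x) (at x within {a..x+1})"
    by (rule integral_has_vector_derivative[OF cont]) (simp add: a_def)
  then have "((\<lambda>y. integral {a..y} phi) has_vector_derivative phi x) (at x)"
    by (subst (asm) at_within_interior) (auto simp: a_def)
  then have "((\<lambda>y. Phi a + integral {a..y} phi) has_real_derivative phi x) (at x)"
    by (auto simp: has_real_derivative_iff_has_vector_derivative intro!: derivative_eq_intros)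
  then show ?thesis
  proof (rule has_field_derivative_transform_within_open[where S="{a<..<x+1}"])
    show "Phi a + integral {a..y} phi = Phi y" if "y \<in> {a<..<x+1}" for y
      using eq[of y] that by simp
  qed (auto simp: a_def)
qed

lemma Phi_tendsto_1: "(Phi \<longlongrightarrow> 1) at_top"
  and Phi_tendsto_0: "(Phi \<longlongrightarrow> 0) at_bot"
  by (rule std_normal.top std_normal.bot)+

lemma Phi_strict_mono: "x < y \<Longrightarrow> Phi x < Phi y"
  by (rule DERIV_pos_imp_increasing) (auto intro!: DERIV_Phi exI phi_pos)

lemma Phi_mono: "x \<le> y \<Longrightarrow> Phi x \<le> Phi y"
  using std_normal.mono by (auto simp: mono_def)

lemma Phi_pos: "0 < Phi x"
  using Phi_strict_mono[of "x - 1" x] std_normal.cdf_nonneg[of "x - 1"] by simp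

lemma Phi_less_1: "Phi x < 1"
  using Phi_strict_mono[of x "x + 1"] std_normal.cdf_bounded_prob[of "x + 1"] by simp

text \<open>The sum of the two values has derivative 0, because \<open>phi\<close> is even, and
  tends to 1 at infinity.\<close>

lemma Phi_minus: "Phi (- x) = 1 - Phi x"
proof -
  define g where "g = (\<lambda>x. Phi x + Phi (- x))"
  have d: "DERIV g x :> 0" for x
    unfolding g_def
    by (rule DERIV_cong, rule DERIV_add[OF DERIV_Phi DERIV_chain2[OF DERIV_Phi]])
       (auto intro!: derivative_eq_intros simp: phi_minus)
  then have "g = (\<lambda>_. g x)"
    by (auto intro!: ext DERIV_isconst_all[of g])
  moreover have "(g \<longlongrightarrow> 1 + 0) at_top"
    unfolding g_def
    by (intro tendsto_add Phi_tendsto_1 filterlim_compose[OF Phi_tendsto_0] filterlim_uminus_at_bot_at_top)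
  ultimately have "((\<lambda>_. g x) \<longlongrightarrow> 1) (at_top :: real filter)" by simp
  then have "g x = 1" by (simp add: tendsto_const_iff)
  then show ?thesis by (simp add: g_def)
qed

lemma isCont_Phi: "isCont Phi x"
  using DERIV_Phi DERIV_isCont by blast

lemma borel_measurable_Phi [measurable]: "Phi \<in> borel_measurable borel"
  by (rule std_normal.measurable_C)

section \<open>Tail integrals, monotone hazard rate and Mills' inequality\<close>

lemma nn_integral_phi_tail: "(\<integral>\<^sup>+y. ennreal (phi y) * indicator {x..} y \<partial>lborel) = ennreal (1 - Phi x)"
  by (rule nn_integral_FTC_atLeast) (auto intro!: DERIV_Phi Phi_tendsto_1)

text \<open>Translating the tail to the fixed domain \<open>{0..}\<close> lets tails from different
  points be compared integrand by integrand.\<close>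

lemma nn_integral_phi_tail_shift:
  "(\<integral>\<^sup>+r. ennreal (phi (z + r)) * indicator {0..} r \<partial>lborel) = ennreal (1 - Phi z)"
proof -
  have "DERIV (\<lambda>r. Phi (z + r)) r :> phi (z + r)" for r
    using DERIV_shift[of Phi "phi (z + r)" r z] DERIV_Phi[of "z + r"] by (simp add: add.commute)
  moreover have "((\<lambda>r. Phi (z + r)) \<longlongrightarrow> 1) at_top"
    by (rule filterlim_compose[OF Phi_tendsto_1]) real_asymp
  ultimately have "(\<integral>\<^sup>+r. ennreal (phi (z + r)) * indicator {0..} r \<partial>lborel) = ennreal (1 - Phi (z + 0))"
    by (intro nn_integral_FTC_atLeast) auto
  then show ?thesis by simp
qed

text \<open>The hazard rate phi / (1 - Phi) is nondecreasing, in cross-multiplied form.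
  Log-concavity compares the integrands: the exponents of \<open>phi y * phi (x + r)\<close> and
  \<open>phi x * phi (y + r)\<close> differ by \<open>(y - x) * r\<close>, which is nonnegative;
  then r is integrated over \<open>{0..}\<close>.\<close>

lemma hazard_mono:
  assumes "x \<le> y" shows "phi x * (1 - Phi y) \<le> phi y * (1 - Phi x)"
proof -
  define t where "t = y - x"
  have "phi x * phi (y + r) \<le> phi y * phi (x + r)" if "0 \<le> r" for r
  proof -
    have "0 \<le> t * r" using that assms by (auto simp: t_def)
    then show ?thesis
      by (auto simp: std_normal_density_def t_def divide_simps simp flip: exp_add)
         (auto simp: power2_eq_square algebra_simps)
  qed
  then have "ennreal (phi x) * (\<integral>\<^sup>+r. ennreal (phi (y + r)) * indicator {0..} r \<partial>lborel)
     \<le> ennreal (phi y) * (\<integral>\<^sup>+r. ennreal (phi (x + r)) * indicator {0..} r \<partial>lborel)"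
    by (subst (1 2) nn_integral_cmult[symmetric])
       (auto intro!: nn_integral_mono split: split_indicator simp flip: ennreal_mult)
  then show ?thesis
    unfolding nn_integral_phi_tail_shift using Phi_less_1
    by (simp add: less_imp_le flip: ennreal_mult)
qed

text \<open>The reflected statement: phi / Phi is nonincreasing. It bounds the density to the right
  of a point in terms of the density at that point.\<close>

lemma hazard_mono':
  assumes "x \<le> y" shows "phi y * Phi x \<le> phi x * Phi y"
  using hazard_mono[of "- y" "- x"] assms by (simp add: phi_minus Phi_minus)

text \<open>Integrate \<open>x * phi y \<le> y * phi y\<close> over y \<ge> x; the right side has
  the primitive - phi. Negative x is trivial but included, since the bound is later applied to x and
  - x together.\<close>

lemma mills_upper: "x * (1 - Phi x) \<le> phi x"
proof (cases "0 < x")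
  case True
  have "ennreal (x * (1 - Phi x)) = (\<integral>\<^sup>+y. ennreal x * (ennreal (phi y) * indicator {x..} y) \<partial>lborel)"
    using True Phi_less_1[of x] by (subst nn_integral_cmult) (auto simp: nn_integral_phi_tail ennreal_mult)
  also have "\<dots> \<le> (\<integral>\<^sup>+y. ennreal (y * phi y) * indicator {x..} y \<partial>lborel)"
    using True by (intro nn_integral_mono) (auto split: split_indicator simp flip: ennreal_mult intro!: ennreal_leI mult_right_mono)
  also have "\<dots> = ennreal (0 - (- phi x))"
    using True phi_tendsto_0[THEN tendsto_minus]
    by (intro nn_integral_FTC_atLeast) (auto intro!: derivative_eq_intros DERIV_phi)
  finally show ?thesis by simp
next
  case False
  then have "x * (1 - Phi x) \<le> 0" using Phi_less_1[of x] by (simp add: mult_nonpos_nonneg)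
  then show ?thesis using phi_pos[of x] by linarith
qed

text \<open>The value is the mean of the positive part of Z - x for a standard normal Z. The
  primitive is \<open>y * (1 - Phi y) - phi y\<close>, which vanishes at infinity by Mills'
  inequality.\<close>

lemma nn_integral_Phi_tail:
  "(\<integral>\<^sup>+y. ennreal (1 - Phi y) * indicator {x..} y \<partial>lborel) = ennreal (phi x - x * (1 - Phi x))"
proof -
  have "((\<lambda>y. y * (1 - Phi y)) \<longlongrightarrow> 0) at_top"
  proof (rule tendsto_sandwich[OF _ _ tendsto_const phi_tendsto_0])
    show "\<forall>\<^sub>F y in at_top. 0 \<le> y * (1 - Phi y)"
      using eventually_ge_at_top[of 0] by eventually_elim (simp add: Phi_less_1 less_imp_le)
  qed (simp add: mills_upper)
  then have lim: "((\<lambda>y. y * (1 - Phi y) - phi y) \<longlongrightarrow> 0 - 0) at_top"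
    by (intro tendsto_diff phi_tendsto_0)
  have d: "DERIV (\<lambda>y. y * (1 - Phi y) - phi y) y :> 1 - Phi y" for y
    by (auto intro!: derivative_eq_intros DERIV_phi DERIV_Phi)
  have "(\<integral>\<^sup>+y. ennreal (1 - Phi y) * indicator {x..} y \<partial>lborel) = ennreal (0 - (x * (1 - Phi x) - phi x))"
    using lim d Phi_less_1 by (intro nn_integral_FTC_atLeast[OF _ d]) (auto intro: less_imp_le)
  then show ?thesis by simp
qed

text \<open>Monotonicity of the hazard rate \<open>phi / (1 - Phi)\<close>, integrated.\<close>
lemma Phi_tail_exp_bound:
  assumes "0 \<le> t"
  shows "1 - Phi (x + t) \<le> (1 - Phi x) * exp (- (phi x / (1 - Phi x)) * t)"
proof -
  define l where "l = phi x / (1 - Phi x)"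
  define f where "f = (\<lambda>t. (1 - Phi (x + t)) * exp (l * t))"
  have "DERIV f r :> exp (l * r) * (l * (1 - Phi (x + r)) - phi (x + r))" for r
    unfolding f_def
    by (rule DERIV_cong, rule DERIV_mult[OF DERIV_diff[OF DERIV_const DERIV_chain2[OF DERIV_Phi]]])
       (auto intro!: derivative_eq_intros simp: algebra_simps)
  moreover have "exp (l * r) * (l * (1 - Phi (x + r)) - phi (x + r)) \<le> 0" if "0 \<le> r" for r
  proof -
    have "l * (1 - Phi (x + r)) \<le> phi (x + r)"
      using hazard_mono[of x "x + r"] that Phi_less_1[of x] by (simp add: l_def pos_divide_le_eq)
    then show ?thesis by (simp add: mult_nonneg_nonpos)
  qed
  ultimately have "f t \<le> f 0"
    using assms by (intro DERIV_nonpos_imp_nonincreasing[of 0 t f]) auto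
  then show ?thesis
    by (simp add: f_def l_def exp_minus field_simps)
qed

section \<open>The Bregman divergence of the isoperimetric profile\<close>

text \<open>\<open>ennreal\<close> maps negative reals to 0, so the integrand is the positive part
  of q - Phi y. For q \<ge> Phi x this is the area between the level q and the curve Phi to the
  right of x. If q = Phi z, it equals phi x - phi z - x * (q - Phi x), which is the Bregman
  divergence because I' (Phi x) = - x.\<close>

definition excess :: "real \<Rightarrow> real \<Rightarrow> ennreal" where
  "excess x q = (\<integral>\<^sup>+y. ennreal (q - Phi y) * indicator {x..} y \<partial>lborel)"

text \<open>At most one summand is nonzero; the second one is the reflected integral of \<open>(Phi y - q)\<^sup>+\<close> over \<open>y \<le> x\<close>.\<close>
definition bregman :: "real \<Rightarrow> real \<Rightarrow> ennreal" where
  "bregman x q = excess x q + excess (- x) (1 - q)"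

lemma borel_measurable_excess [measurable]:
  "(\<lambda>z. excess (fst z) (snd z)) \<in> borel_measurable (borel \<Otimes>\<^sub>M borel)"
proof -
  have *: "(\<lambda>(z, y). ennreal (snd z - Phi y) * indicator {w. fst (fst w) \<le> snd w} (z, y))
      \<in> borel_measurable ((borel \<Otimes>\<^sub>M borel) \<Otimes>\<^sub>M lborel)"
    by measurable
  have "(\<lambda>z. \<integral>\<^sup>+y. ennreal (snd z - Phi y) * indicator {w. fst (fst w) \<le> snd w} (z, y) \<partial>lborel)
      \<in> borel_measurable (borel \<Otimes>\<^sub>M borel)"
    using lborel.borel_measurable_nn_integral[OF *] by simp
  also have "(\<lambda>z. \<integral>\<^sup>+y. ennreal (snd z - Phi y) * indicator {w. fst (fst w) \<le> snd w} (z, y) \<partial>lborel)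
     = (\<lambda>z. excess (fst z) (snd z))"
    by (auto simp: excess_def fun_eq_iff indicator_def intro!: nn_integral_cong)
  finally show ?thesis .
qed

lemma borel_measurable_bregman [measurable]:
  "(\<lambda>z. bregman (fst z) (snd z)) \<in> borel_measurable (borel \<Otimes>\<^sub>M borel)"
proof -
  have "(\<lambda>z. excess (fst (- fst z, 1 - snd z)) (snd (- fst z, 1 - snd z))) \<in> borel_measurable (borel \<Otimes>\<^sub>M borel)"
    by (rule measurable_compose[OF _ borel_measurable_excess]) measurable
  then show ?thesis by (simp add: bregman_def)
qed

lemma excess_eq_0: "q \<le> Phi x \<Longrightarrow> excess x q = 0"
proof -
  assume "q \<le> Phi x"
  then have "ennreal (q - Phi y) * indicator {x..} y = 0" for y
    using Phi_mono[of x y] by (auto simp: indicator_def ennreal_neg)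
  then have "(\<lambda>y. ennreal (q - Phi y) * indicator {x..} y) = (\<lambda>_. 0)"
    by (rule ext)
  then show ?thesis by (simp only: excess_def) simp
qed

text \<open>Since q * Phi y \<le> Phi y, the integrand is at most q * (1 - Phi y), whose integral is
  explicit. The bound is linear in q, so that its expectation requires only the mean of q.\<close>

lemma excess_le_affine:
  assumes "0 \<le> q" "q \<le> 1"
  shows "excess x q \<le> ennreal (q * (phi x - x * (1 - Phi x)))"
proof -
  have "ennreal (q - Phi y) \<le> ennreal q * ennreal (1 - Phi y)" for y
    using assms Phi_pos[of y] Phi_less_1[of y] mult_left_le_one_le[of "Phi y" q]
    by (auto simp: algebra_simps less_imp_le intro!: ennreal_leI simp flip: ennreal_mult)
  then have "excess x q \<le> (\<integral>\<^sup>+y. ennreal q * (ennreal (1 - Phi y) * indicator {x..} y) \<partial>lborel)"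
    unfolding excess_def by (intro nn_integral_mono) (auto split: split_indicator)
  also have "\<dots> = ennreal (q * (phi x - x * (1 - Phi x)))"
    using assms mills_upper[of x] by (subst nn_integral_cmult) (auto simp: nn_integral_Phi_tail ennreal_mult)
  finally show ?thesis .
qed

text \<open>Multiply ln (1 - s) \<le> - s - s^2 / 2 by 1 - s. The left side is the normalised excess
  of an exponential tail, where s is the fraction of the tail mass by which the level is
  raised.\<close>

lemma one_minus_mul_ln_le:
  fixes s :: real assumes "0 \<le> s" "s < 1"
  shows "s + (1 - s) * ln (1 - s) \<le> s\<^sup>2 / 2 + s ^ 3 / 2"
proof -
  define g where "g = (\<lambda>t::real. ln (1 - t) + t + t\<^sup>2 / 2)"
  have "\<exists>y. DERIV g t :> y \<and> y \<le> 0" if "0 \<le> t" "t \<le> s" for t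
  proof (intro exI conjI)
    show "DERIV g t :> - 1 / (1 - t) + 1 + t"
      using that assms unfolding g_def by (auto intro!: derivative_eq_intros simp: power2_eq_square)
    have "- 1 / (1 - t) + 1 + t = - (t\<^sup>2 / (1 - t))"
      using that assms by (simp add: field_simps power2_eq_square)
    then show "- 1 / (1 - t) + 1 + t \<le> 0"
      using that assms by simp
  qed
  then have "g s \<le> g 0"
    using assms(1) DERIV_nonpos_imp_nonincreasing[of 0 s g] by blast
  then have "ln (1 - s) \<le> - s - s\<^sup>2 / 2" by (simp add: g_def)
  then have "(1 - s) * ln (1 - s) \<le> (1 - s) * (- s - s\<^sup>2 / 2)"
    using assms by (intro mult_left_mono) auto
  also have "\<dots> = - s + s\<^sup>2 / 2 + s ^ 3 / 2"
    by (simp add: field_simps power2_eq_square power3_eq_cube)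
  finally show ?thesis by simp
qed

text \<open>To the right of x, 1 - Phi lies below the exponential tail with the same mass v and the
  same hazard rate l at x. The excess over that tail is v / l * (s + (1 - s) * ln (1 - s)), and v /
  l * s^2 / 2 is the leading term (q - Phi x)^2 / (2 * phi x).\<close>

lemma excess_upper:
  assumes "Phi x \<le> q" "q \<le> 1"
  shows "excess x q \<le> ennreal ((q - Phi x)\<^sup>2 / (2 * phi x) + (q - Phi x) ^ 3 / (2 * (1 - Phi x) * phi x))"
proof -
  define v where "v = 1 - Phi x"
  define l where "l = phi x / v"
  define s where "s = (q - Phi x) / v"
  have v: "0 < v" "v < 1" using Phi_pos[of x] Phi_less_1[of x] by (auto simp: v_def)
  have l: "0 < l" using v phi_pos by (simp add: l_def)
  have s: "0 \<le> s" "s \<le> 1" using assms v by (auto simp: s_def v_def)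
  have vs: "v * s = q - Phi x" using v by (simp add: s_def)
  have q: "1 - q = v * (1 - s)" unfolding right_diff_distrib vs by (simp add: v_def)
  have eq: "(q - Phi x)\<^sup>2 / (2 * phi x) + (q - Phi x) ^ 3 / (2 * (1 - Phi x) * phi x) = v / l * (s\<^sup>2 / 2 + s ^ 3 / 2)"
    unfolding v_def[symmetric] l_def s_def using v phi_pos[of x]
    by (simp add: field_simps power2_eq_square power3_eq_cube)
  have "excess x q = (\<integral>\<^sup>+t. ennreal (q - Phi (x + t)) * indicator {0..} t \<partial>lborel)"
    unfolding excess_def
    by (subst nn_integral_real_affine[where c=1 and t=x]) (auto simp: indicator_def intro!: nn_integral_cong)
  also have "\<dots> \<le> (\<integral>\<^sup>+t. ennreal (v * exp (- l * t) - v * (1 - s)) * indicator {0..} t \<partial>lborel)"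
  proof (intro nn_integral_mono)
    fix t :: real
    have "q - Phi (x + t) \<le> v * exp (- l * t) - v * (1 - s)" if "0 \<le> t"
      using Phi_tail_exp_bound[OF that, of x] q unfolding l_def v_def by linarith
    then show "ennreal (q - Phi (x + t)) * indicator {0..} t \<le> ennreal (v * exp (- l * t) - v * (1 - s)) * indicator {0..} t"
      by (auto split: split_indicator intro: ennreal_leI)
  qed
  also have "\<dots> \<le> ennreal (v / l * (s\<^sup>2 / 2 + s ^ 3 / 2))"
  proof (cases "s = 1")
    \<comment> \<open>Here q = 1: the exponential never crosses the level, so its whole tail is
      integrated. The result v / l agrees with the bound, as s^2 / 2 + s^3 / 2 = 1.\<close>
    case True
    have lim: "((\<lambda>t. - (v / l) * exp (- l * t)) \<longlongrightarrow> 0) at_top"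
      using l by real_asymp
    have "(\<integral>\<^sup>+t. ennreal (v * exp (- l * t)) * indicator {0..} t \<partial>lborel) = ennreal (0 - (- (v / l) * exp (- l * 0)))"
      using v l by (intro nn_integral_FTC_atLeast[OF _ _ _ lim]) (auto intro!: derivative_eq_intros)
    then show ?thesis using True by simp
  next
    case False
    then have s1: "s < 1" using s by simp
    \<comment> \<open>The point where the exponential tail has fallen to 1 - q; beyond it
      \<open>ennreal\<close> cuts the integrand to 0.\<close>
    define t0 where "t0 = - ln (1 - s) / l"
    have t0: "0 \<le> t0" using s s1 l by (simp add: t0_def divide_nonpos_pos)
    have lt0: "l * t0 = - ln (1 - s)" using l by (simp add: t0_def)
    have sgn: "v * exp (- l * t) - v * (1 - s) \<ge> 0 \<longleftrightarrow> t \<le> t0" for t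
    proof -
      have "v * exp (- l * t) - v * (1 - s) \<ge> 0 \<longleftrightarrow> 1 - s \<le> exp (- l * t)"
        using v by (simp add: zero_le_mult_iff flip: right_diff_distrib)
      also have "\<dots> \<longleftrightarrow> ln (1 - s) \<le> - l * t"
        using s1 ln_le_cancel_iff[of "1 - s" "exp (- l * t)"] by simp
      also have "\<dots> \<longleftrightarrow> l * t \<le> l * t0" using lt0 by auto
      finally show ?thesis using l by simp
    qed
    have "(\<integral>\<^sup>+t. ennreal (v * exp (- l * t) - v * (1 - s)) * indicator {0..} t \<partial>lborel)
        = (\<integral>\<^sup>+t. ennreal (v * exp (- l * t) - v * (1 - s)) * indicator {0..t0} t \<partial>lborel)"
    proof (intro nn_integral_cong)
      fix t
      show "ennreal (v * exp (- l * t) - v * (1 - s)) * indicator {0..} t = ennreal (v * exp (- l * t) - v * (1 - s)) * indicator {0..t0} t"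
        using sgn[of t] by (auto split: split_indicator simp: ennreal_neg)
    qed
    also have "\<dots> = ennreal ((- (v / l) * exp (- l * t0) - v * (1 - s) * t0) - (- (v / l) * exp (- l * 0) - v * (1 - s) * 0))"
      using l t0 sgn by (intro nn_integral_FTC_Icc) (auto intro!: derivative_eq_intros)
    also have "(- (v / l) * exp (- l * t0) - v * (1 - s) * t0) - (- (v / l) * exp (- l * 0) - v * (1 - s) * 0)
        = v / l * (s + (1 - s) * ln (1 - s))"
      using lt0 l s1 by (simp add: t0_def field_simps)
    finally show ?thesis
      using one_minus_mul_ln_le[OF s(1) s1] v l
      by (auto intro!: ennreal_leI divide_right_mono mult_left_mono)
  qed
  finally show ?thesis unfolding eq .
qed

text \<open>While Phi stays below q, the monotone ratio phi / Phi keeps its slope below L = phi x *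
  q / p. Hence the area contains a triangle of height d = q - p and base d / L, of area d^2 / (2 *
  L).\<close>

lemma excess_lower:
  assumes "Phi x \<le> q" "q \<le> 1"
  shows "ennreal ((q - Phi x)\<^sup>2 / (2 * phi x) - (q - Phi x) ^ 3 / (2 * Phi x * phi x)) \<le> excess x q"
proof -
  define p where "p = Phi x"
  define d where "d = q - p"
  define L where "L = phi x * q / p"
  have p: "0 < p" using Phi_pos by (simp add: p_def)
  have q: "0 < q" using assms p by (simp add: p_def)
  have L: "0 < L" using p q phi_pos[of x] by (simp add: L_def)
  have d: "0 \<le> d" using assms by (simp add: d_def p_def)
  have lip: "Phi y - p \<le> L * (y - x)" if "x \<le> y" "Phi y \<le> q" for y
  proof (cases "x = y")
    case False
    then have "x < y" using that by simp
    then obtain z where z: "x < z" "z < y" "Phi y - Phi x = (y - x) * phi z"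
      using MVT2[of x y Phi phi] DERIV_Phi by blast
    have "phi z * p \<le> phi x * q"
      using hazard_mono'[of x z] z Phi_mono[of z y] that phi_pos[of x]
      by (smt (verit) mult_left_mono p_def)
    then have "phi z \<le> L" using p by (simp add: L_def field_simps)
    then show ?thesis using z by (simp add: p_def mult.commute mult_left_mono)
  qed (simp add: p_def)
  have main: "ennreal (d - L * (y - x)) \<le> ennreal (q - Phi y)" if xy: "x \<le> y" for y
  proof (cases "Phi y \<le> q")
    case True
    then show ?thesis using lip[OF xy] by (intro ennreal_leI) (simp add: d_def)
  next
    case False
    then have "q \<le> Phi y" by simp
    \<comment> \<open>At the crossing point z, where Phi z = q, the line has already reached 0, so
      at y its value is nonpositive and is cut to 0.\<close>
    then obtain z where z: "x \<le> z" "z \<le> y" "Phi z = q"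
      using IVT[OF assms(1) \<open>q \<le> Phi y\<close> xy] isCont_Phi by (metis (no_types))
    have "L * (z - x) \<le> L * (y - x)" using z L by simp
    then show ?thesis using lip[of z] z by (simp add: d_def ennreal_neg)
  qed
  have "d\<^sup>2 / (2 * phi x) - d ^ 3 / (2 * p * phi x) \<le> d\<^sup>2 / (2 * L)"
  proof -
    have "d\<^sup>2 / (2 * phi x) - d ^ 3 / (2 * p * phi x) = d\<^sup>2 / (2 * phi x) * ((p - d) / p)"
      using p phi_pos[of x] by (simp add: field_simps power2_eq_square power3_eq_cube)
    \<comment> \<open>With q = p + d this is (p - d) * (p + d) \<le> p^2; it turns the factor p / q
      into the linear correction 1 - d / p.\<close>
    also have "(p - d) * q \<le> p * p"
      unfolding d_def using zero_le_square[of "q - p"] by (simp add: algebra_simps)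
    then have "(p - d) / p \<le> p / q"
      using p q by (simp add: divide_simps mult.commute)
    then have "d\<^sup>2 / (2 * phi x) * ((p - d) / p) \<le> d\<^sup>2 / (2 * phi x) * (p / q)"
      using phi_pos[of x] by (intro mult_left_mono) auto
    also have "\<dots> = d\<^sup>2 / (2 * L)" by (simp add: L_def)
    finally show ?thesis .
  qed
  then have "ennreal (d\<^sup>2 / (2 * phi x) - d ^ 3 / (2 * p * phi x)) \<le> ennreal (d\<^sup>2 / (2 * L))"
    by (rule ennreal_leI)
  also have "d\<^sup>2 / (2 * L) = (d * (x + d / L) - L * ((x + d / L) - x)\<^sup>2 / 2) - (d * x - L * (x - x)\<^sup>2 / 2)"
    using L by (simp add: field_simps power2_eq_square)
  also have "ennreal \<dots> = (\<integral>\<^sup>+y. ennreal (d - L * (y - x)) * indicator {x..x + d / L} y \<partial>lborel)"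
    using L d by (intro nn_integral_FTC_Icc[symmetric])
      (auto intro!: derivative_eq_intros simp: field_simps)
  also have "\<dots> \<le> excess x q"
    unfolding excess_def using main by (intro nn_integral_mono) (auto split: split_indicator)
  finally show ?thesis by (simp add: d_def p_def)
qed

lemma bregman_eq:
  "bregman x q = (if Phi x \<le> q then excess x q else excess (- x) (1 - q))"
  by (auto simp: bregman_def excess_eq_0 Phi_minus)

text \<open>The one-sided bounds produce either tail as denominator; passing to the smaller one
  gives a single formula for both signs of q - Phi x.\<close>

lemma cube_div_min_mono:
  assumes "m = Phi x \<or> m = 1 - Phi x" "0 \<le> d"
  shows "d ^ 3 / (2 * m * phi x) \<le> d ^ 3 / min (Phi x) (1 - Phi x) / (2 * phi x)"
proof -
  have "d ^ 3 / m \<le> d ^ 3 / min (Phi x) (1 - Phi x)"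
    using assms Phi_pos[of x] Phi_less_1[of x] by (intro divide_left_mono) auto
  then have "d ^ 3 / m / (2 * phi x) \<le> d ^ 3 / min (Phi x) (1 - Phi x) / (2 * phi x)"
    using phi_pos[of x] by (intro divide_right_mono) auto
  then show ?thesis by (simp add: mult.commute mult.left_commute)
qed

lemma bregman_upper:
  assumes "0 \<le> q" "q \<le> 1"
  shows "bregman x q \<le> ennreal ((\<bar>q - Phi x\<bar>\<^sup>2 + \<bar>q - Phi x\<bar> ^ 3 / min (Phi x) (1 - Phi x)) / (2 * phi x))"
proof (cases "Phi x \<le> q")
  case True
  have "bregman x q \<le> ennreal ((q - Phi x)\<^sup>2 / (2 * phi x) + (q - Phi x) ^ 3 / (2 * (1 - Phi x) * phi x))"
    using excess_upper[OF True] assms True by (simp add: bregman_eq)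
  also have "\<dots> \<le> ennreal ((\<bar>q - Phi x\<bar>\<^sup>2 + \<bar>q - Phi x\<bar> ^ 3 / min (Phi x) (1 - Phi x)) / (2 * phi x))"
    using cube_div_min_mono[of "1 - Phi x" x "q - Phi x"] True
    by (intro ennreal_leI) (simp add: add_divide_distrib)
  finally show ?thesis .
next
  case False
  have "bregman x q \<le> ennreal ((Phi x - q)\<^sup>2 / (2 * phi x) + (Phi x - q) ^ 3 / (2 * Phi x * phi x))"
    using excess_upper[of "- x" "1 - q"] assms False by (simp add: bregman_eq Phi_minus phi_minus)
  also have "\<dots> \<le> ennreal ((\<bar>q - Phi x\<bar>\<^sup>2 + \<bar>q - Phi x\<bar> ^ 3 / min (Phi x) (1 - Phi x)) / (2 * phi x))"
    using cube_div_min_mono[of "Phi x" x "Phi x - q"] False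
    by (intro ennreal_leI) (simp add: add_divide_distrib power2_commute)
  finally show ?thesis .
qed

text \<open>The bound carries information only while the deviation is below the smaller tail mass;
  past that the real expression is nonpositive and \<open>ennreal\<close> makes it 0. The case q <
  Phi x is the reflection x to - x, q to 1 - q.\<close>

lemma bregman_lower:
  assumes "0 \<le> q" "q \<le> 1"
  shows "ennreal ((\<bar>q - Phi x\<bar>\<^sup>2 - \<bar>q - Phi x\<bar> ^ 3 / min (Phi x) (1 - Phi x)) / (2 * phi x)) \<le> bregman x q"
proof (cases "Phi x \<le> q")
  case True
  have "ennreal ((\<bar>q - Phi x\<bar>\<^sup>2 - \<bar>q - Phi x\<bar> ^ 3 / min (Phi x) (1 - Phi x)) / (2 * phi x))
     \<le> ennreal ((q - Phi x)\<^sup>2 / (2 * phi x) - (q - Phi x) ^ 3 / (2 * Phi x * phi x))"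
    using cube_div_min_mono[of "Phi x" x "q - Phi x"] True
    by (intro ennreal_leI) (simp add: diff_divide_distrib)
  also have "\<dots> \<le> bregman x q"
    using excess_lower[OF True] assms True by (simp add: bregman_eq)
  finally show ?thesis .
next
  case False
  have "ennreal ((\<bar>q - Phi x\<bar>\<^sup>2 - \<bar>q - Phi x\<bar> ^ 3 / min (Phi x) (1 - Phi x)) / (2 * phi x))
     \<le> ennreal ((Phi x - q)\<^sup>2 / (2 * phi x) - (Phi x - q) ^ 3 / (2 * (1 - Phi x) * phi x))"
    using cube_div_min_mono[of "1 - Phi x" x "Phi x - q"] False
    by (intro ennreal_leI) (simp add: diff_divide_distrib power2_commute)
  also have "\<dots> \<le> bregman x q"
    using excess_lower[of "- x" "1 - q"] assms False by (simp add: bregman_eq Phi_minus phi_minus)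
  finally show ?thesis .
qed

text \<open>A deviation never exceeds the tail on its own side, so the cubic term is at most the
  quadratic one. The leading constant doubles, but the bound remains usable where F_n fluctuates as
  much as the tail itself.\<close>

lemma bregman_le_sq:
  assumes "0 \<le> q" "q \<le> 1"
  shows "bregman x q \<le> ennreal ((q - Phi x)\<^sup>2 / phi x)"
proof (cases "Phi x \<le> q")
  case True
  have "bregman x q \<le> ennreal ((q - Phi x)\<^sup>2 / (2 * phi x) + (q - Phi x) ^ 3 / (2 * (1 - Phi x) * phi x))"
    using excess_upper[OF True] assms True by (simp add: bregman_eq)
  also have "(q - Phi x) ^ 3 / (2 * (1 - Phi x) * phi x) = (q - Phi x)\<^sup>2 / (2 * phi x) * ((q - Phi x) / (1 - Phi x))"
    by (simp add: power2_eq_square power3_eq_cube)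
  also have "\<dots> \<le> (q - Phi x)\<^sup>2 / (2 * phi x) * 1"
    using True assms phi_pos[of x] Phi_less_1[of x] by (intro mult_left_mono) auto
  finally show ?thesis using phi_pos[of x] by (simp add: ennreal_leI)
next
  case False
  have "bregman x q \<le> ennreal ((Phi x - q)\<^sup>2 / (2 * phi x) + (Phi x - q) ^ 3 / (2 * Phi x * phi x))"
    using excess_upper[of "- x" "1 - q"] assms False by (simp add: bregman_eq Phi_minus phi_minus)
  also have "(Phi x - q) ^ 3 / (2 * Phi x * phi x) = (Phi x - q)\<^sup>2 / (2 * phi x) * ((Phi x - q) / Phi x)"
    by (simp add: power2_eq_square power3_eq_cube)
  also have "\<dots> \<le> (Phi x - q)\<^sup>2 / (2 * phi x) * 1"
    using False assms phi_pos[of x] Phi_pos[of x] by (intro mult_left_mono) auto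
  finally show ?thesis using phi_pos[of x] by (simp add: ennreal_leI power2_commute)
qed

lemma bregman_le_affine:
  assumes "0 \<le> q" "q \<le> 1"
  shows "bregman x q \<le> ennreal (phi x - x * (q - Phi x))"
proof -
  have "bregman x q \<le> ennreal (q * (phi x - x * (1 - Phi x))) + ennreal ((1 - q) * (phi x + x * Phi x))"
    unfolding bregman_def using excess_le_affine[of q x] excess_le_affine[of "1 - q" "- x"] assms
    by (intro add_mono) (auto simp: Phi_minus phi_minus)
  also have "\<dots> = ennreal (q * (phi x - x * (1 - Phi x)) + (1 - q) * (phi x + x * Phi x))"
    using assms mills_upper[of x] mills_upper[of "- x"]
    by (intro ennreal_plus[symmetric]) (auto simp: phi_minus Phi_minus)
  also have "q * (phi x - x * (1 - Phi x)) + (1 - q) * (phi x + x * Phi x) = phi x - x * (q - Phi x)"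
    by (simp add: algebra_simps)
  finally show ?thesis .
qed

section \<open>Pathwise representation of the Wasserstein distance\<close>

text \<open>Half the squared positive gap is the area of a triangle above the diagonal. Writing it
  as a double integral is what allows Fubini to exchange quantiles for distribution
  functions.\<close>

lemma nn_integral_ordered_gap:
  fixes a b :: real
  shows "(\<integral>\<^sup>+x. \<integral>\<^sup>+y. indicator {(x, y). a \<le> x \<and> x \<le> y \<and> y < b} (x, y) \<partial>lborel \<partial>lborel)
     = ennreal ((max 0 (b - a))\<^sup>2 / 2)"
proof -
  have "(\<integral>\<^sup>+y. indicator {(x, y). a \<le> x \<and> x \<le> y \<and> y < b} (x, y) \<partial>lborel)
      = ennreal (b - x) * indicator {a..max a b} x" for x
  proof -
    have "(\<integral>\<^sup>+y. indicator {(x, y). a \<le> x \<and> x \<le> y \<and> y < b} (x, y) \<partial>lborel)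
        = (\<integral>\<^sup>+y. indicator {a..} x * indicator {x..<b} y \<partial>lborel)"
      by (intro nn_integral_cong) (auto split: split_indicator)
    also have "\<dots> = indicator {a..} x * emeasure lborel {x..<b}"
      by (subst nn_integral_cmult) auto
    also have "\<dots> = ennreal (b - x) * indicator {a..max a b} x"
      by (cases "x \<le> b") (auto split: split_indicator simp: ennreal_neg)
    finally show ?thesis .
  qed
  then have "(\<integral>\<^sup>+x. \<integral>\<^sup>+y. indicator {(x, y). a \<le> x \<and> x \<le> y \<and> y < b} (x, y) \<partial>lborel \<partial>lborel)
      = (\<integral>\<^sup>+x. ennreal (b - x) * indicator {a..max a b} x \<partial>lborel)"
    by simp
  also have "\<dots> = (\<integral>\<^sup>+x. ennreal (max a b - x) * indicator {a..max a b} x \<partial>lborel)"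
    by (intro nn_integral_cong) (auto split: split_indicator simp: max_def ennreal_neg)
  also have "\<dots> = ennreal (- (max a b - max a b)\<^sup>2 / 2 - (- (max a b - a)\<^sup>2 / 2))"
    by (intro nn_integral_FTC_Icc) (auto intro!: derivative_eq_intros simp: field_simps)
  also have "- (max a b - max a b)\<^sup>2 / 2 - (- (max a b - a)\<^sup>2 / 2) = (max 0 (b - a))\<^sup>2 / 2"
    by (auto simp: max_def)
  finally show ?thesis .
qed

text \<open>For 0 < u < 1 the equivalence of \<open>u \<le> F x\<close> with
  \<open>quantile F u \<le> x\<close> makes this the indicator of quantile F u \<le> x \<le> y <
  quantile G u, expressed without quantiles.\<close>

definition gap_ind :: "(real \<Rightarrow> real) \<Rightarrow> (real \<Rightarrow> real) \<Rightarrow> real \<Rightarrow> real \<Rightarrow> real \<Rightarrow> ennreal" where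
  "gap_ind F G u x y = (if 0 < u \<and> u < 1 \<and> u \<le> F x \<and> x \<le> y \<and> G y < u then 1 else 0)"

lemma borel_measurable_gap_ind:
  assumes [measurable]: "F \<in> borel_measurable borel" "G \<in> borel_measurable borel"
  shows "(\<lambda>(p, y). gap_ind F G (fst p) (snd p) y) \<in> borel_measurable ((borel \<Otimes>\<^sub>M borel) \<Otimes>\<^sub>M lborel)"
    and "(\<lambda>(u, x). \<integral>\<^sup>+y. gap_ind F G u x y \<partial>lborel) \<in> borel_measurable (borel \<Otimes>\<^sub>M lborel)"
    and "(\<lambda>u. \<integral>\<^sup>+x. \<integral>\<^sup>+y. gap_ind F G u x y \<partial>lborel \<partial>lborel) \<in> borel_measurable lborel"
    and "(\<lambda>(u, y). gap_ind F G u x y) \<in> borel_measurable (borel \<Otimes>\<^sub>M borel)"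
proof -
  show 1: "(\<lambda>(p, y). gap_ind F G (fst p) (snd p) y) \<in> borel_measurable ((borel \<Otimes>\<^sub>M borel) \<Otimes>\<^sub>M lborel)"
    unfolding gap_ind_def by measurable
  show 2: "(\<lambda>(u, x). \<integral>\<^sup>+y. gap_ind F G u x y \<partial>lborel) \<in> borel_measurable (borel \<Otimes>\<^sub>M lborel)"
    using lborel.borel_measurable_nn_integral[OF 1] by (simp add: split_beta')
  show "(\<lambda>u. \<integral>\<^sup>+x. \<integral>\<^sup>+y. gap_ind F G u x y \<partial>lborel \<partial>lborel) \<in> borel_measurable lborel"
    using lborel.borel_measurable_nn_integral[OF 2] by simp
  show "(\<lambda>(u, y). gap_ind F G u x y) \<in> borel_measurable (borel \<Otimes>\<^sub>M borel)"
    unfolding gap_ind_def by measurable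
qed

text \<open>Integrating over u innermost leaves the length of the interval of all u with G y < u
  \<le> F x. The bounds on F and G keep this interval inside the unit interval.\<close>

lemma nn_integral_gap_swap:
  assumes FG: "F \<in> borel_measurable borel" "G \<in> borel_measurable borel"
    and F: "\<And>x. F x \<le> 1" and G: "\<And>x. 0 \<le> G x"
  shows "(\<integral>\<^sup>+u. \<integral>\<^sup>+x. \<integral>\<^sup>+y. gap_ind F G u x y \<partial>lborel \<partial>lborel \<partial>lborel)
      = (\<integral>\<^sup>+x. \<integral>\<^sup>+y. ennreal (F x - G y) * indicator {x..} y \<partial>lborel \<partial>lborel)"
proof -
  have "(\<integral>\<^sup>+u. \<integral>\<^sup>+x. \<integral>\<^sup>+y. gap_ind F G u x y \<partial>lborel \<partial>lborel \<partial>lborel)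
      = (\<integral>\<^sup>+x. \<integral>\<^sup>+u. \<integral>\<^sup>+y. gap_ind F G u x y \<partial>lborel \<partial>lborel \<partial>lborel)"
    using borel_measurable_gap_ind(2)[OF FG]
    by (intro lborel_pair.Fubini'[symmetric]) (simp add: split_beta')
  also have "\<dots> = (\<integral>\<^sup>+x. \<integral>\<^sup>+y. \<integral>\<^sup>+u. gap_ind F G u x y \<partial>lborel \<partial>lborel \<partial>lborel)"
    using borel_measurable_gap_ind(4)[OF FG]
    by (intro nn_integral_cong lborel_pair.Fubini'[symmetric]) (simp add: split_beta')
  also have "\<dots> = (\<integral>\<^sup>+x. \<integral>\<^sup>+y. ennreal (F x - G y) * indicator {x..} y \<partial>lborel \<partial>lborel)"
  proof (intro nn_integral_cong)
    fix x y
    have "(\<integral>\<^sup>+u. gap_ind F G u x y \<partial>lborel) = (\<integral>\<^sup>+u. indicator {x..} y * indicator {G y<..F x} u \<partial>lborel)"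
    proof (intro nn_integral_cong_AE, use AE_lborel_singleton[of "1::real"] in eventually_elim)
      \<comment> \<open>The value u = 1 is excluded by \<open>gap_ind\<close> but may lie in
        \<open>{G y<..F x}\<close>; it is discarded as a null set.\<close>
      case (elim u)
      have "F x \<le> 1" "0 \<le> G y" by (rule F G)+
      then show ?case using elim by (auto simp: gap_ind_def indicator_def)
    qed
    also have "\<dots> = indicator {x..} y * emeasure lborel {G y<..F x}"
      by (subst nn_integral_cmult) auto
    also have "emeasure lborel {G y<..F x} = ennreal (F x - G y)"
      by (cases "G y \<le> F x") (simp_all add: ennreal_neg)
    finally show "(\<integral>\<^sup>+u. gap_ind F G u x y \<partial>lborel) = ennreal (F x - G y) * indicator {x..} y"
      by (simp add: mult.commute)
  qed
  finally show ?thesis .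
qed

lemma quantile_le_iff:
  assumes "right_continuous_mono F 0 1" "0 < u" "u < 1"
  shows "u \<le> F x \<longleftrightarrow> quantile F u \<le> x"
  unfolding quantile_def by (rule right_continuous_mono.pseudoinverse[OF assms])

lemma right_continuous_mono_bounds:
  assumes "right_continuous_mono F 0 1" shows "0 \<le> F x" "F x \<le> 1"
proof -
  interpret right_continuous_mono F 0 1 by fact
  show "0 \<le> F x"
    using bot by (rule tendsto_upperbound) (auto simp: eventually_at_bot_linorder intro!: exI[of _ x] monoD[OF mono])
  show "F x \<le> 1"
    using top by (rule tendsto_lowerbound) (auto simp: eventually_at_top_linorder intro!: exI[of _ x] monoD[OF mono])
qed

lemma right_continuous_mono_Phi: "right_continuous_mono Phi 0 1"
  by (rule std_normal.right_continuous_mono_axioms)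

lemma borel_measurable_quantile:
  assumes "right_continuous_mono F 0 1"
  shows "quantile F \<in> borel_measurable (restrict_space borel {0<..<1})"
proof -
  have "mono_on {0<..<1} (quantile F)"
    using right_continuous_mono.mono_I[OF assms] by (simp add: quantile_def[abs_def])
  then show ?thesis by (rule borel_measurable_mono_on_fnc)
qed

text \<open>The square of the quantile difference is twice the sum of two triangle areas, one for
  each sign. After the swap they become the two summands of \<open>bregman\<close>.
  \<open>enn2real\<close> sends infinity to 0, as the Bochner integral does for a non-integrable
  function, so the two sides also agree in the infinite case.\<close>

lemma W2_sq_eq:
  assumes F: "right_continuous_mono F 0 1"
  shows "(W2 F Phi)\<^sup>2 = enn2real (2 * (\<integral>\<^sup>+x. bregman x (F x) \<partial>lborel))"
proof -
  interpret F: right_continuous_mono F 0 1 by fact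
  have [measurable]: "F \<in> borel_measurable borel"
    by (rule borel_measurable_mono[OF F.mono])
  let ?I = "{0<..<1::real}"
  let ?d = "\<lambda>u. indicator ?I u *\<^sub>R \<bar>quantile F u - quantile Phi u\<bar>\<^sup>2"
  have "(\<lambda>u. \<bar>quantile F u - quantile Phi u\<bar>\<^sup>2) \<in> borel_measurable (restrict_space borel ?I)"
    using borel_measurable_quantile[OF F] borel_measurable_quantile[OF right_continuous_mono_Phi] by measurable
  then have m: "?d \<in> borel_measurable lborel"
    by (subst (asm) borel_measurable_restrict_space_iff) auto
  have pt: "ennreal (?d u) = 2 * (\<integral>\<^sup>+x. \<integral>\<^sup>+y. gap_ind F Phi u x y \<partial>lborel \<partial>lborel)
      + 2 * (\<integral>\<^sup>+x. \<integral>\<^sup>+y. gap_ind Phi F u x y \<partial>lborel \<partial>lborel)" for u :: real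
  proof (cases "u \<in> ?I")
    case True
    note q = quantile_le_iff[OF F, of u] quantile_le_iff[OF right_continuous_mono_Phi, of u]
    have "gap_ind F Phi u x y = indicator {(x, y). quantile F u \<le> x \<and> x \<le> y \<and> y < quantile Phi u} (x, y)" for x y
      using True q[of x] q[of y] by (auto simp: gap_ind_def indicator_def)
    moreover have "gap_ind Phi F u x y = indicator {(x, y). quantile Phi u \<le> x \<and> x \<le> y \<and> y < quantile F u} (x, y)" for x y
      using True q[of x] q[of y] by (auto simp: gap_ind_def indicator_def)
    moreover have "ennreal ((a - b)\<^sup>2) = 2 * ennreal ((max 0 (b - a))\<^sup>2 / 2) + 2 * ennreal ((max 0 (a - b))\<^sup>2 / 2)" for a b :: real
    proof -
      have "2 * ennreal t = ennreal (2 * t)" if "0 \<le> t" for t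
        using that by (simp add: ennreal_mult)
      then have "2 * ennreal ((max 0 (b - a))\<^sup>2 / 2) + 2 * ennreal ((max 0 (a - b))\<^sup>2 / 2)
          = ennreal ((max 0 (b - a))\<^sup>2) + ennreal ((max 0 (a - b))\<^sup>2)"
        by simp
      then show ?thesis by (auto simp: max_def power2_commute)
    qed
    ultimately show ?thesis using True by (simp only: nn_integral_ordered_gap) simp
  next
    case False
    then have z: "gap_ind G H u x y = 0" for G H x y by (auto simp: gap_ind_def)
    show ?thesis using False by (simp add: z)
  qed
  have Fm: "F \<in> borel_measurable borel" "Phi \<in> borel_measurable borel" by measurable
  have nn: "(\<integral>\<^sup>+u. ennreal (?d u) \<partial>lborel) = 2 * (\<integral>\<^sup>+x. bregman x (F x) \<partial>lborel)"
  proof -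
    have e1: "(\<integral>\<^sup>+u. \<integral>\<^sup>+x. \<integral>\<^sup>+y. gap_ind F Phi u x y \<partial>lborel \<partial>lborel \<partial>lborel) = (\<integral>\<^sup>+x. excess x (F x) \<partial>lborel)"
      using nn_integral_gap_swap[OF Fm right_continuous_mono_bounds(2)[OF F] less_imp_le[OF Phi_pos]]
      by (simp add: excess_def)
    have "(\<integral>\<^sup>+u. \<integral>\<^sup>+x. \<integral>\<^sup>+y. gap_ind Phi F u x y \<partial>lborel \<partial>lborel \<partial>lborel)
       = (\<integral>\<^sup>+x. \<integral>\<^sup>+y. ennreal (Phi x - F y) * indicator {x..} y \<partial>lborel \<partial>lborel)"
      by (rule nn_integral_gap_swap[OF Fm(2,1) less_imp_le[OF Phi_less_1] right_continuous_mono_bounds(1)[OF F]])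
    \<comment> \<open>In this triangle F is evaluated at the upper coordinate y. To obtain an outer
      integral over the argument of F, the order is exchanged; the reflection x to - x then turns
      the inner integral over x \<le> y into an \<open>excess\<close>.\<close>
    also have "\<dots> = (\<integral>\<^sup>+x. \<integral>\<^sup>+y. ennreal (Phi x - F y) * (if x \<le> y then 1 else 0) \<partial>lborel \<partial>lborel)"
      by (intro nn_integral_cong) (simp add: indicator_def)
    also have "\<dots> = (\<integral>\<^sup>+y. \<integral>\<^sup>+x. ennreal (Phi x - F y) * (if x \<le> y then 1 else 0) \<partial>lborel \<partial>lborel)"
      by (rule lborel_pair.Fubini'[symmetric]) measurable
    also have "\<dots> = (\<integral>\<^sup>+x. excess (- x) (1 - F x) \<partial>lborel)"
    proof (intro nn_integral_cong)
      fix y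
      have "(\<integral>\<^sup>+x. ennreal (Phi x - F y) * (if x \<le> y then 1 else 0) \<partial>lborel)
          = (\<integral>\<^sup>+x. ennreal (Phi (- x) - F y) * (if - x \<le> y then 1 else 0) \<partial>lborel)"
        by (subst nn_integral_real_affine[where c="-1" and t=0]) auto
      also have "\<dots> = excess (- y) (1 - F y)"
        unfolding excess_def by (intro nn_integral_cong) (auto simp: indicator_def Phi_minus algebra_simps)
      finally show "(\<integral>\<^sup>+x. ennreal (Phi x - F y) * (if x \<le> y then 1 else 0) \<partial>lborel) = excess (- y) (1 - F y)" .
    qed
    finally have e2: "(\<integral>\<^sup>+u. \<integral>\<^sup>+x. \<integral>\<^sup>+y. gap_ind Phi F u x y \<partial>lborel \<partial>lborel \<partial>lborel) = (\<integral>\<^sup>+x. excess (- x) (1 - F x) \<partial>lborel)" .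
    have [measurable]: "(\<lambda>x. excess x (F x)) \<in> borel_measurable borel"
      "(\<lambda>x. excess (- x) (1 - F x)) \<in> borel_measurable borel"
      using measurable_compose[OF _ borel_measurable_excess, of "\<lambda>x. (x, F x)" borel]
        measurable_compose[OF _ borel_measurable_excess, of "\<lambda>x. (- x, 1 - F x)" borel] by simp_all
    note [measurable] = borel_measurable_gap_ind(3)[OF Fm] borel_measurable_gap_ind(3)[OF Fm(2,1)]
    show ?thesis
      unfolding pt bregman_def
      by (simp add: nn_integral_add nn_integral_cmult e1 e2 distrib_left)
  qed
  have "(W2 F Phi)\<^sup>2 = (\<integral>u. ?d u \<partial>lborel)"
    unfolding W2_def set_lebesgue_integral_def
    by (rule real_sqrt_pow2) (auto intro!: integral_nonneg_AE)
  also have "\<dots> = enn2real (\<integral>\<^sup>+u. ennreal (?d u) \<partial>lborel)"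
    by (rule integral_eq_nn_integral[OF m]) auto
  finally show ?thesis unfolding nn .
qed

lemma right_continuous_mono_empirical_cdf:
  assumes "1 \<le> n"
  shows "right_continuous_mono (empirical_cdf X n \<omega>) 0 1"
proof
  fix x :: real
  have "continuous (at_right x) (\<lambda>y. of_bool (a \<le> y) :: real)" for a
  proof (cases "a \<le> x")
    case True
    then have "\<forall>\<^sub>F y in at_right x. (of_bool (a \<le> y) :: real) = of_bool (a \<le> x)"
      unfolding eventually_at_right_field by (auto intro!: exI[of _ "x + 1"])
    then show ?thesis by (simp add: continuous_within tendsto_eventually)
  next
    case False
    then have "\<forall>\<^sub>F y in at_right x. (of_bool (a \<le> y) :: real) = of_bool (a \<le> x)"
      unfolding eventually_at_right_field by (auto intro!: exI[of _ a])
    then show ?thesis by (simp add: continuous_within tendsto_eventually)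
  qed
  then show "continuous (at_right x) (empirical_cdf X n \<omega>)"
    unfolding empirical_cdf_def[abs_def] by (intro continuous_intros)
next
  show "mono (empirical_cdf X n \<omega>)"
    unfolding empirical_cdf_def[abs_def]
    by (intro monoI mult_left_mono sum_mono) auto
next
  have "((\<lambda>y. of_bool (a \<le> y) :: real) \<longlongrightarrow> 0) at_bot" for a :: real
    using eventually_gt_at_bot[of a]
    by (intro tendsto_eventually) (auto elim!: eventually_mono simp: eventually_at_bot_dense intro!: exI[of _ a])
  then have "((\<lambda>y. (1 / real n) * (\<Sum>i=1..n. of_bool (X i \<omega> \<le> y))) \<longlongrightarrow> (1 / real n) * (\<Sum>i=1..n. 0)) at_bot"
    by (intro tendsto_intros)
  then show "(empirical_cdf X n \<omega> \<longlongrightarrow> 0) at_bot"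
    by (simp add: empirical_cdf_def[abs_def])
next
  have "((\<lambda>y. of_bool (a \<le> y) :: real) \<longlongrightarrow> 1) at_top" for a :: real
    using eventually_ge_at_top[of a] by (intro tendsto_eventually) (auto elim!: eventually_mono)
  then have "((\<lambda>y. (1 / real n) * (\<Sum>i=1..n. of_bool (X i \<omega> \<le> y))) \<longlongrightarrow> (1 / real n) * (\<Sum>i=1..n. 1)) at_top"
    by (intro tendsto_intros)
  then show "(empirical_cdf X n \<omega> \<longlongrightarrow> 1) at_top"
    using assms by (simp add: empirical_cdf_def[abs_def])
qed

section \<open>Moments of the empirical process\<close>

context prob_space begin

text \<open>The sums up to n depend only on the first n variables, hence are independent of the next
  one; boundedness supplies integrability. Arbitrary exponents are allowed so that every term of the
  expansions in the moment recursions is an instance.\<close>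

lemma expectation_power_mult_indep:
  fixes X :: "nat \<Rightarrow> 'a \<Rightarrow> real" and f g :: "real \<Rightarrow> real"
  assumes X: "indep_vars (\<lambda>_. borel) X {1..}"
    and fm [measurable]: "f \<in> borel_measurable borel" "g \<in> borel_measurable borel"
    and bd: "\<And>x. \<bar>f x\<bar> \<le> 1" "\<And>x. \<bar>g x\<bar> \<le> 1"
  defines "A \<equiv> \<lambda>n \<omega>. \<Sum>i=1..n. f (X i \<omega>)" and "B \<equiv> \<lambda>n \<omega>. \<Sum>i=1..n. g (X i \<omega>)"
  shows "integrable M (\<lambda>\<omega>. A n \<omega> ^ i * B n \<omega> ^ j * (f (X (Suc n) \<omega>) ^ k * g (X (Suc n) \<omega>) ^ l))" (is ?int)
    and "expectation (\<lambda>\<omega>. A n \<omega> ^ i * B n \<omega> ^ j * (f (X (Suc n) \<omega>) ^ k * g (X (Suc n) \<omega>) ^ l))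
      = expectation (\<lambda>\<omega>. A n \<omega> ^ i * B n \<omega> ^ j) * expectation (\<lambda>\<omega>. f (X (Suc n) \<omega>) ^ k * g (X (Suc n) \<omega>) ^ l)" (is ?eq)
proof -
  have Xm [measurable]: "X i \<in> borel_measurable M" if "1 \<le> i" for i
    using X that by (auto simp: indep_vars_def)
  have Am [measurable]: "A n \<in> borel_measurable M" "B n \<in> borel_measurable M"
    unfolding A_def B_def by (auto intro!: borel_measurable_sum measurable_compose[OF Xm fm(1)] measurable_compose[OF Xm fm(2)])
  have Sm [measurable]: "X (Suc n) \<in> borel_measurable M" by (rule Xm) simp
  have "\<bar>\<Sum>i=1..n. h (X i \<omega>)\<bar> \<le> real n" if "\<And>x. \<bar>h x\<bar> \<le> 1" for h :: "real \<Rightarrow> real" and \<omega>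
    by (rule order_trans[OF sum_abs]) (use sum_mono[of "{1..n}" "\<lambda>i. \<bar>h (X i \<omega>)\<bar>" "\<lambda>_. 1"] that in simp)
  then have bdA: "\<bar>A n \<omega>\<bar> \<le> real n" "\<bar>B n \<omega>\<bar> \<le> real n" for \<omega>
    using bd by (auto simp: A_def B_def)
  have i1: "integrable M (\<lambda>\<omega>. A n \<omega> ^ i * B n \<omega> ^ j)"
    using bdA by (intro integrable_const_bound[where B="real n ^ i * real n ^ j"])
      (auto simp: abs_mult power_abs intro!: mult_mono power_mono)
  have i2: "integrable M (\<lambda>\<omega>. f (X (Suc n) \<omega>) ^ k * g (X (Suc n) \<omega>) ^ l)"
    using bd by (intro integrable_const_bound[where B="1 ^ k * 1 ^ l"])
      (auto simp: abs_mult power_abs simp del: power_one intro!: mult_mono power_mono)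
  have "indep_var (PiM {1..n} (\<lambda>_. borel)) (\<lambda>\<omega>. restrict (\<lambda>i. X i \<omega>) {1..n})
      (PiM {Suc n} (\<lambda>_. borel)) (\<lambda>\<omega>. restrict (\<lambda>i. X i \<omega>) {Suc n})"
    by (rule indep_var_restrict[OF X]) auto
  then have "indep_var borel
     ((\<lambda>v. (\<Sum>i=1..n. f (v i)) ^ i * (\<Sum>i=1..n. g (v i)) ^ j) \<circ> (\<lambda>\<omega>. restrict (\<lambda>i. X i \<omega>) {1..n}))
     borel ((\<lambda>v. f (v (Suc n)) ^ k * g (v (Suc n)) ^ l) \<circ> (\<lambda>\<omega>. restrict (\<lambda>i. X i \<omega>) {Suc n}))"
    by (rule indep_var_compose) measurable
  also have "(\<lambda>v. (\<Sum>i=1..n. f (v i)) ^ i * (\<Sum>i=1..n. g (v i)) ^ j) \<circ> (\<lambda>\<omega>. restrict (\<lambda>i. X i \<omega>) {1..n})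
     = (\<lambda>\<omega>. A n \<omega> ^ i * B n \<omega> ^ j)"
    by (auto simp: fun_eq_iff A_def B_def)
  also have "(\<lambda>v. f (v (Suc n)) ^ k * g (v (Suc n)) ^ l) \<circ> (\<lambda>\<omega>. restrict (\<lambda>i. X i \<omega>) {Suc n})
     = (\<lambda>\<omega>. f (X (Suc n) \<omega>) ^ k * g (X (Suc n) \<omega>) ^ l)"
    by (auto simp: fun_eq_iff)
  finally have ind: "indep_var borel (\<lambda>\<omega>. A n \<omega> ^ i * B n \<omega> ^ j) borel (\<lambda>\<omega>. f (X (Suc n) \<omega>) ^ k * g (X (Suc n) \<omega>) ^ l)" .
  show ?int by (rule indep_var_integrable[OF ind i1 i2])
  show ?eq by (rule indep_var_lebesgue_integral[OF ind i1 i2])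
qed

text \<open>Induction on n: expand the powers of the sums after adding one term, and factor each
  monomial by independence. The coefficient a * b + 2 * c^2 is the mixed fourth moment of a centred
  Gaussian pair with these variances and covariance; the linear term n bounds the accumulated fourth
  moments of single summands.\<close>

lemma moments_sum_centered:
  fixes X :: "nat \<Rightarrow> 'a \<Rightarrow> real" and f g :: "real \<Rightarrow> real"
  assumes X: "indep_vars (\<lambda>_. borel) X {1..}"
    and fm: "f \<in> borel_measurable borel" "g \<in> borel_measurable borel"
    and bd: "\<And>x. \<bar>f x\<bar> \<le> 1" "\<And>x. \<bar>g x\<bar> \<le> 1"
    and f0: "\<And>i. 1 \<le> i \<Longrightarrow> expectation (\<lambda>\<omega>. f (X i \<omega>)) = 0"
    and g0: "\<And>i. 1 \<le> i \<Longrightarrow> expectation (\<lambda>\<omega>. g (X i \<omega>)) = 0"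
    and f2: "\<And>i. 1 \<le> i \<Longrightarrow> expectation (\<lambda>\<omega>. (f (X i \<omega>))\<^sup>2) = a"
    and g2: "\<And>i. 1 \<le> i \<Longrightarrow> expectation (\<lambda>\<omega>. (g (X i \<omega>))\<^sup>2) = b"
    and fg: "\<And>i. 1 \<le> i \<Longrightarrow> expectation (\<lambda>\<omega>. f (X i \<omega>) * g (X i \<omega>)) = c"
  defines "A \<equiv> \<lambda>n \<omega>. \<Sum>i=1..n. f (X i \<omega>)" and "B \<equiv> \<lambda>n \<omega>. \<Sum>i=1..n. g (X i \<omega>)"
  shows "expectation (A n) = 0"
    and "expectation (\<lambda>\<omega>. (A n \<omega>)\<^sup>2) = n * a"
    and "expectation (\<lambda>\<omega>. (A n \<omega>)\<^sup>2 * (B n \<omega>)\<^sup>2) \<le> (real n)\<^sup>2 * (a * b + 2 * c\<^sup>2) + n"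
proof -
  define T where "T n i j k l \<omega> = A n \<omega> ^ i * B n \<omega> ^ j * (f (X (Suc n) \<omega>) ^ k * g (X (Suc n) \<omega>) ^ l)" for n i j k l \<omega>
  define e where "e n i j = expectation (\<lambda>\<omega>. A n \<omega> ^ i * B n \<omega> ^ j)" for n i j
  define m where "m n k l = expectation (\<lambda>\<omega>. f (X (Suc n) \<omega>) ^ k * g (X (Suc n) \<omega>) ^ l)" for n k l
  have Ti [simp]: "integrable M (T n i j k l)" for n i j k l
    unfolding T_def A_def B_def by (rule expectation_power_mult_indep(1)[OF X fm bd])
  have Te [simp]: "expectation (T n i j k l) = e n i j * m n k l" for n i j k l
    unfolding T_def e_def m_def A_def B_def by (rule expectation_power_mult_indep(2)[OF X fm bd])
  have AS: "A (Suc n) \<omega> = A n \<omega> + f (X (Suc n) \<omega>)" "B (Suc n) \<omega> = B n \<omega> + g (X (Suc n) \<omega>)" for n \<omega>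
    by (auto simp: A_def B_def)
  have m: "m n 0 0 = 1" "m n 1 0 = 0" "m n 0 1 = 0" "m n 2 0 = a" "m n 0 2 = b" "m n 1 1 = c" for n
    using f0[of "Suc n"] g0[of "Suc n"] f2[of "Suc n"] g2[of "Suc n"] fg[of "Suc n"]
    by (auto simp: m_def prob_space)
  note m' [simp] = m[unfolded One_nat_def]
  have Xm: "X i \<in> borel_measurable M" if "1 \<le> i" for i
    using X that by (auto simp: indep_vars_def)
  have m22: "m n 2 2 \<le> 1" for n
  proof -
    have "m n 2 2 \<le> expectation (\<lambda>\<omega>. 1)"
      unfolding m_def
    proof (intro integral_mono)
      show "integrable M (\<lambda>\<omega>. (f (X (Suc n) \<omega>))\<^sup>2 * (g (X (Suc n) \<omega>))\<^sup>2)"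
        using Ti[of n 0 0 2 2] by (simp add: T_def[abs_def])
      show "(f (X (Suc n) \<omega>))\<^sup>2 * (g (X (Suc n) \<omega>))\<^sup>2 \<le> 1" for \<omega>
        using bd by (intro mult_le_one) (auto simp: abs_square_le_1)
    qed simp
    then show ?thesis by (simp add: prob_space)
  qed
  have e00 [simp]: "e n 0 0 = 1" for n by (simp add: e_def prob_space)
  have base: "e 0 i j = 0 ^ i * 0 ^ j" for i j by (simp add: e_def A_def B_def prob_space)
  have e10: "e n 1 0 = 0" for n
  proof (induction n)
    case (Suc n)
    have "e (Suc n) 1 0 = expectation (\<lambda>\<omega>. T n 1 0 0 0 \<omega> + T n 0 0 1 0 \<omega>)"
      unfolding e_def T_def AS by (intro Bochner_Integration.integral_cong) (auto simp: algebra_simps)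
    then show ?case using Suc by simp
  qed (simp add: base)
  note e10' [simp] = e10[unfolded One_nat_def]
  have e01: "e n 0 1 = 0" for n
  proof (induction n)
    case (Suc n)
    have "e (Suc n) 0 1 = expectation (\<lambda>\<omega>. T n 0 1 0 0 \<omega> + T n 0 0 0 1 \<omega>)"
      unfolding e_def T_def AS by (intro Bochner_Integration.integral_cong) (auto simp: algebra_simps)
    then show ?case using Suc by simp
  qed (simp add: base)
  note e01' [simp] = e01[unfolded One_nat_def]
  have e20 [simp]: "e n 2 0 = n * a" for n
  proof (induction n)
    case (Suc n)
    have "e (Suc n) 2 0 = expectation (\<lambda>\<omega>. T n 2 0 0 0 \<omega> + 2 * T n 1 0 1 0 \<omega> + T n 0 0 2 0 \<omega>)"
      unfolding e_def T_def AS by (intro Bochner_Integration.integral_cong) (auto simp: algebra_simps power2_eq_square)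
    then show ?case using Suc by (simp add: algebra_simps)
  qed (simp add: base)
  have e02 [simp]: "e n 0 2 = n * b" for n
  proof (induction n)
    case (Suc n)
    have "e (Suc n) 0 2 = expectation (\<lambda>\<omega>. T n 0 2 0 0 \<omega> + 2 * T n 0 1 0 1 \<omega> + T n 0 0 0 2 \<omega>)"
      unfolding e_def T_def AS by (intro Bochner_Integration.integral_cong) (auto simp: algebra_simps power2_eq_square)
    then show ?case using Suc by (simp add: algebra_simps)
  qed (simp add: base)
  have e11: "e n 1 1 = n * c" for n
  proof (induction n)
    case (Suc n)
    have "e (Suc n) 1 1 = expectation (\<lambda>\<omega>. T n 1 1 0 0 \<omega> + T n 1 0 0 1 \<omega> + T n 0 1 1 0 \<omega> + T n 0 0 1 1 \<omega>)"
      unfolding e_def T_def AS by (intro Bochner_Integration.integral_cong) (auto simp: algebra_simps)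
    then show ?case using Suc by (simp add: algebra_simps)
  qed (simp add: base)
  note e11' [simp] = e11[unfolded One_nat_def]
  \<comment> \<open>The third-order moments \<open>e n 2 1\<close> and \<open>e n 1 2\<close> need
    no evaluation: each comes multiplied by the vanishing mean of the new term.\<close>
  have e22S: "e (Suc n) 2 2 = e n 2 2 + n * a * b + 4 * n * c\<^sup>2 + n * b * a + m n 2 2" for n
  proof -
    have "e (Suc n) 2 2 = expectation (\<lambda>\<omega>. T n 2 2 0 0 \<omega> + 2 * T n 2 1 0 1 \<omega> + T n 2 0 0 2 \<omega>
        + 2 * T n 1 2 1 0 \<omega> + 4 * T n 1 1 1 1 \<omega> + 2 * T n 1 0 1 2 \<omega>
        + T n 0 2 2 0 \<omega> + 2 * T n 0 1 2 1 \<omega> + T n 0 0 2 2 \<omega>)"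
      unfolding e_def T_def AS by (intro Bochner_Integration.integral_cong) (auto simp: algebra_simps power2_eq_square)
    then show ?thesis by (simp add: algebra_simps power2_eq_square)
  qed
  have "a \<ge> 0" "b \<ge> 0" using f2[of 1, symmetric] g2[of 1, symmetric] by (auto intro!: integral_nonneg_AE)
  then have ab: "0 \<le> a * b" by simp
  have e22: "e n 2 2 \<le> (real n)\<^sup>2 * (a * b + 2 * c\<^sup>2) + n"
  proof (induction n)
    case (Suc n)
    have "e (Suc n) 2 2 \<le> ((real n)\<^sup>2 * (a * b + 2 * c\<^sup>2) + n) + 2 * n * (a * b + 2 * c\<^sup>2) + 1"
      unfolding e22S using Suc m22[of n] by (simp add: algebra_simps)
    \<comment> \<open>The increment 2 * n is enlarged to (n + 1)^2 - n^2 = 2 * n + 1, which uses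
      nonnegativity of the coefficient.\<close>
    also have "\<dots> \<le> (real (Suc n))\<^sup>2 * (a * b + 2 * c\<^sup>2) + Suc n"
      using ab by (simp add: power2_eq_square algebra_simps)
    finally show ?case .
  qed (simp add: base)
  show "expectation (A n) = 0" using e10[of n] by (simp add: e_def)
  show "expectation (\<lambda>\<omega>. (A n \<omega>)\<^sup>2) = n * a" using e20[of n] by (simp add: e_def)
  show "expectation (\<lambda>\<omega>. (A n \<omega>)\<^sup>2 * (B n \<omega>)\<^sup>2) \<le> (real n)\<^sup>2 * (a * b + 2 * c\<^sup>2) + n"
    using e22 by (simp add: e_def)
qed

end

locale iid_std_normal = prob_space +
  fixes X :: "nat \<Rightarrow> 'a \<Rightarrow> real"
  assumes indep: "indep_vars (\<lambda>_. borel) X {1..}"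
    and distr_X: "1 \<le> i \<Longrightarrow> distributed M lborel (X i) phi"
begin

lemma measurable_X [measurable]: "1 \<le> i \<Longrightarrow> X i \<in> borel_measurable M"
  using indep by (auto simp: indep_vars_def)

lemma expectation_X_le:
  assumes "1 \<le> i" shows "expectation (\<lambda>\<omega>. of_bool (X i \<omega> \<le> x)) = Phi x"
proof -
  have "expectation (\<lambda>\<omega>. of_bool (X i \<omega> \<le> x)) = expectation (\<lambda>\<omega>. indicator {..x} (X i \<omega>) :: real)"
    by (intro Bochner_Integration.integral_cong) (auto simp: indicator_def)
  also have "\<dots> = (\<integral>t. indicator {..x} t \<partial>distr M lborel (X i))"
    using measurable_X[OF assms] by (intro integral_distr[symmetric]) auto
  also have "distr M lborel (X i) = density lborel phi"
    using distr_X[OF assms] by (simp add: distributed_def)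
  finally show ?thesis
    by (simp add: std_normal_cdf_def cdf_def)
qed

text \<open>The empirical process without the factor sqrt n: it stays bounded by 1, and its moments
  carry explicit powers of 1 / n.\<close>

definition dev :: "nat \<Rightarrow> real \<Rightarrow> 'a \<Rightarrow> real" where
  "dev n x \<omega> = empirical_cdf X n \<omega> x - Phi x"

lemma measurable_empirical_cdf:
  "(\<lambda>z. empirical_cdf X n (fst z) (snd z)) \<in> borel_measurable (M \<Otimes>\<^sub>M borel)"
proof -
  have "(\<lambda>z. of_bool (X i (fst z) \<le> snd z) :: real) \<in> borel_measurable (M \<Otimes>\<^sub>M borel)" if "1 \<le> i" for i
  proof -
    have [measurable]: "X i \<in> borel_measurable M" using that by simp
    show ?thesis unfolding of_bool_def by measurable
  qed
  then show ?thesis unfolding empirical_cdf_def by (intro borel_measurable_times borel_measurable_sum) auto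
qed

lemma measurable_dev: "(\<lambda>z. dev n (snd z) (fst z)) \<in> borel_measurable (M \<Otimes>\<^sub>M borel)"
  unfolding dev_def using measurable_empirical_cdf by measurable

lemma empirical_cdf_bounds: "0 \<le> empirical_cdf X n \<omega> x" "empirical_cdf X n \<omega> x \<le> 1"
proof -
  show "0 \<le> empirical_cdf X n \<omega> x" unfolding empirical_cdf_def by (intro mult_nonneg_nonneg sum_nonneg) auto
  have "(\<Sum>i=1..n. of_bool (X i \<omega> \<le> x) :: real) \<le> (\<Sum>i=1..n. 1)" by (intro sum_mono) auto
  then show "empirical_cdf X n \<omega> x \<le> 1" by (auto simp: empirical_cdf_def divide_le_eq_1)
qed

lemma abs_G_le_1: "\<bar>dev n x \<omega>\<bar> \<le> 1"
  using empirical_cdf_bounds[of n \<omega> x] Phi_pos[of x] Phi_less_1[of x] by (simp add: dev_def abs_le_iff)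

lemma dev_eq: "1 \<le> n \<Longrightarrow> dev n x \<omega> = (\<Sum>i=1..n. of_bool (X i \<omega> \<le> x) - Phi x) / n"
  by (simp add: dev_def empirical_cdf_def sum_subtractf diff_divide_distrib)

text \<open>Centred indicators are fed into \<open>moments_sum_centered\<close>; their covariance
  Phi (min x y) - Phi x * Phi y is that of a time-changed Brownian bridge.\<close>

lemma dev_moments:
  assumes n: "1 \<le> n"
  shows "expectation (dev n x) = 0"
    and "expectation (\<lambda>\<omega>. (dev n x \<omega>)\<^sup>2) = Phi x * (1 - Phi x) / n"
    and "expectation (\<lambda>\<omega>. (dev n x \<omega>)\<^sup>2 * (dev n y \<omega>)\<^sup>2) \<le>
      (Phi x * (1 - Phi x) * (Phi y * (1 - Phi y)) + 2 * (Phi (min x y) - Phi x * Phi y)\<^sup>2) / (real n)\<^sup>2 + 1 / real n ^ 3"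
proof -
  define f where "f x = (\<lambda>t::real. of_bool (t \<le> x) - Phi x)" for x
  have fm: "f x \<in> borel_measurable borel" for x
    unfolding f_def of_bool_def by measurable
  have bd: "\<bar>f x t\<bar> \<le> 1" for x t
    using Phi_pos[of x] Phi_less_1[of x] by (auto simp: f_def)
  have int: "integrable M (\<lambda>\<omega>. of_bool (X i \<omega> \<le> x) :: real)" if "1 \<le> i" for i x
  proof -
    have [measurable]: "X i \<in> borel_measurable M" using that by simp
    show ?thesis by (intro integrable_const_bound[where B=1]) (auto simp: of_bool_def)
  qed
  have e1: "expectation (\<lambda>\<omega>. f x (X i \<omega>)) = 0" if "1 \<le> i" for i x
    using that by (simp add: f_def int expectation_X_le prob_space)
  have e2: "expectation (\<lambda>\<omega>. f x (X i \<omega>) * f y (X i \<omega>)) = Phi (min x y) - Phi x * Phi y" if i: "1 \<le> i" for i x y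
  proof -
    have "expectation (\<lambda>\<omega>. f x (X i \<omega>) * f y (X i \<omega>)) = expectation (\<lambda>\<omega>. of_bool (X i \<omega> \<le> min x y)
        - Phi y * of_bool (X i \<omega> \<le> x) - Phi x * of_bool (X i \<omega> \<le> y) + Phi x * Phi y)"
      by (intro Bochner_Integration.integral_cong) (auto simp: f_def algebra_simps)
    then show ?thesis using i by (simp add: int expectation_X_le prob_space del: min.bounded_iff)
  qed
  have e3: "expectation (\<lambda>\<omega>. (f x (X i \<omega>))\<^sup>2) = Phi x * (1 - Phi x)" if i: "1 \<le> i" for i x
    using e2[OF i, of x x] by (simp add: power2_eq_square algebra_simps)
  note mom = moments_sum_centered[OF indep fm[of x] fm[of y] bd[of x] bd[of y] e1 e1 e3 e3 e2]
  have Gf: "dev n x = (\<lambda>\<omega>. (\<Sum>i=1..n. f x (X i \<omega>)) / n)" for x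
    using n by (auto simp: dev_eq f_def)
  show "expectation (dev n x) = 0"
    unfolding Gf using mom(1)[of n] by simp
  show "expectation (\<lambda>\<omega>. (dev n x \<omega>)\<^sup>2) = Phi x * (1 - Phi x) / n"
    unfolding Gf using mom(2)[of n] n by (simp add: power_divide power2_eq_square)
  have "expectation (\<lambda>\<omega>. (dev n x \<omega>)\<^sup>2 * (dev n y \<omega>)\<^sup>2)
      = expectation (\<lambda>\<omega>. (\<Sum>i=1..n. f x (X i \<omega>))\<^sup>2 * (\<Sum>i=1..n. f y (X i \<omega>))\<^sup>2) / real n ^ 4"
    unfolding Gf by (simp add: power_divide flip: power_add)
  also have "\<dots> \<le> ((real n)\<^sup>2 * (Phi x * (1 - Phi x) * (Phi y * (1 - Phi y)) + 2 * (Phi (min x y) - Phi x * Phi y)\<^sup>2) + n) / real n ^ 4"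
    using mom(3)[of n] by (intro divide_right_mono) auto
  also have "\<dots> = (Phi x * (1 - Phi x) * (Phi y * (1 - Phi y)) + 2 * (Phi (min x y) - Phi x * Phi y)\<^sup>2) / (real n)\<^sup>2 + 1 / real n ^ 3"
    using n by (simp add: add_divide_distrib power_numeral_reduce)
  finally show "expectation (\<lambda>\<omega>. (dev n x \<omega>)\<^sup>2 * (dev n y \<omega>)\<^sup>2) \<le>
      (Phi x * (1 - Phi x) * (Phi y * (1 - Phi y)) + 2 * (Phi (min x y) - Phi x * Phi y)\<^sup>2) / (real n)\<^sup>2 + 1 / real n ^ 3" .
qed

end

text \<open>The covariance factors as Phi (min x y) * (1 - Phi (max x y)), and monotonicity of Phi
  bounds this product by either tail at x.\<close>

lemma Phi_cov_sq_le:
  assumes "\<bar>y\<bar> \<le> \<bar>x\<bar>"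
  shows "(Phi (min x y) - Phi x * Phi y)\<^sup>2 \<le> (min (Phi x) (1 - Phi x))\<^sup>2"
proof -
  define m where "m = min (Phi x) (1 - Phi x)"
  note b = Phi_pos[of x] Phi_pos[of y] Phi_less_1[of x] Phi_less_1[of y]
  have "Phi (min x y) - Phi x * Phi y = Phi (min x y) * (1 - Phi (max x y))"
    by (auto simp: min_def max_def algebra_simps)
  moreover have "Phi (min x y) * (1 - Phi (max x y)) \<le> m"
  proof (cases "x \<le> y")
    case True
    have "Phi x * (1 - Phi y) \<le> Phi x" "Phi x * (1 - Phi y) \<le> 1 - Phi y" "1 - Phi y \<le> 1 - Phi x"
      using b True Phi_mono by (auto simp: mult_left_le mult_left_le_one_le)
    then show ?thesis using True by (simp add: m_def min_def max_def)
  next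
    case False
    have "Phi y * (1 - Phi x) \<le> Phi y" "Phi y * (1 - Phi x) \<le> 1 - Phi x" "Phi y \<le> Phi x"
      using b False Phi_mono[of y x] by (auto simp: mult_left_le mult_left_le_one_le)
    then show ?thesis using False by (simp add: m_def min_def max_def)
  qed
  moreover have "0 \<le> Phi (min x y) * (1 - Phi (max x y))"
    using Phi_pos Phi_less_1 by (simp add: less_imp_le)
  ultimately show ?thesis unfolding m_def by (simp add: power_mono)
qed

section \<open>The weight 1 / phi and the asymptotics of the variance integral\<close>

lemma Fubini_bounded:
  fixes f :: "'a \<Rightarrow> 'b \<Rightarrow> real"
  assumes M1: "finite_measure M1" and M2: "finite_measure M2"
    and m: "(\<lambda>z. f (fst z) (snd z)) \<in> borel_measurable (M1 \<Otimes>\<^sub>M M2)"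
    and bd: "\<And>x y. \<bar>f x y\<bar> \<le> C"
  shows "integrable M1 (\<lambda>x. \<integral>y. f x y \<partial>M2)"
    and "integrable M2 (\<lambda>y. \<integral>x. f x y \<partial>M1)"
    and "(\<integral>x. (\<integral>y. f x y \<partial>M2) \<partial>M1) = (\<integral>y. (\<integral>x. f x y \<partial>M1) \<partial>M2)"
proof -
  interpret M1: finite_measure M1 by fact
  interpret M2: finite_measure M2 by fact
  interpret pair_sigma_finite M1 M2 by standard
  have "finite_measure (M1 \<Otimes>\<^sub>M M2)"
    by (rule finite_measure_pair_measure[OF M2 M1])
  then have i: "integrable (M1 \<Otimes>\<^sub>M M2) (\<lambda>(x, y). f x y)"
    using m bd by (intro finite_measure.integrable_const_bound[where B=C]) (auto simp: split_beta')
  show "integrable M1 (\<lambda>x. \<integral>y. f x y \<partial>M2)" by (rule integrable_fst[OF i])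
  show "integrable M2 (\<lambda>y. \<integral>x. f x y \<partial>M1)" by (rule integrable_snd[OF i])
  show "(\<integral>x. (\<integral>y. f x y \<partial>M2) \<partial>M1) = (\<integral>y. (\<integral>x. f x y \<partial>M1) \<partial>M2)"
    by (rule Fubini_integral[OF i, symmetric])
qed

text \<open>1 / phi is not integrable over the line; cutting it at s gives a finite measure, for
  which all bounded measurable functions are integrable and Fubini is available.\<close>

definition weight :: "real \<Rightarrow> real measure" where
  "weight s = density lborel (\<lambda>x. ennreal (indicator {-s..s} x / phi x))"

definition var_integral :: "real \<Rightarrow> real" where
  "var_integral s = (\<integral>x. Phi x * (1 - Phi x) \<partial>weight s)"

definition tail_min :: "real \<Rightarrow> real" where
  "tail_min x = min (Phi x) (1 - Phi x)"

lemma tail_min_pos: "0 < tail_min x"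
  by (simp add: tail_min_def Phi_pos Phi_less_1)

lemma borel_measurable_tail_min [measurable]: "tail_min \<in> borel_measurable borel"
  unfolding tail_min_def[abs_def] by measurable

lemma tail_min_abs: "tail_min x = 1 - Phi \<bar>x\<bar>"
  using Phi_mono[of x "- x"] Phi_mono[of "- x" x] by (auto simp: tail_min_def abs_if Phi_minus min_def)

lemma tail_min_mono: "\<bar>x\<bar> \<le> s \<Longrightarrow> 1 - Phi s \<le> tail_min x"
  using Phi_mono[of "\<bar>x\<bar>" s] by (simp add: tail_min_abs)

lemma var_eq_tail_min: "Phi x * (1 - Phi x) = tail_min x * (1 - tail_min x)"
  by (auto simp: tail_min_def min_def)

lemma var_le_tail_min: "Phi x * (1 - Phi x) \<le> tail_min x"
  using tail_min_pos[of x] unfolding var_eq_tail_min by (simp add: mult_left_le)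

lemma tail_min_le_var: "tail_min x \<le> 2 * (Phi x * (1 - Phi x))"
proof -
  have "tail_min x \<le> 1 / 2" by (auto simp: tail_min_def min_def)
  then have "tail_min x * 1 \<le> tail_min x * (2 * (1 - tail_min x))"
    using tail_min_pos[of x] by (intro mult_left_mono) auto
  then show ?thesis unfolding var_eq_tail_min by (simp add: algebra_simps)
qed

text \<open>Mills' inequality on both sides: variance over phi is at most 1 / |x|, which is why the
  variance integral grows only logarithmically.\<close>

lemma abs_mult_tail_min: "\<bar>x\<bar> * tail_min x \<le> phi x"
  using mills_upper[of "\<bar>x\<bar>"] by (cases "0 \<le> x") (simp_all add: tail_min_abs phi_minus)

lemma tail_min_le_1: "tail_min x \<le> 1" 
  using Phi_less_1[of x] by (simp add: tail_min_def)

lemma sets_weight [measurable_cong, simp]: "sets (weight s) = sets borel"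
  and space_weight [simp]: "space (weight s) = UNIV"
  by (simp_all add: weight_def)

lemma nn_integral_weight:
  assumes [measurable]: "f \<in> borel_measurable borel"
  shows "(\<integral>\<^sup>+x. f x \<partial>weight s) = (\<integral>\<^sup>+x. ennreal (indicator {-s..s} x / phi x) * f x \<partial>lborel)"
  unfolding weight_def by (rule nn_integral_density) measurable

text \<open>1 / phi is largest at the endpoints. The factor t in this crude bound is absorbed by
  Mills' inequality in \<open>cov_sq_integral_le\<close>.\<close>

lemma emeasure_weight_Icc:
  assumes "0 \<le> t" shows "emeasure (weight s) {-t..t} \<le> ennreal (2 * t / phi t)"
proof -
  have "emeasure (weight s) {-t..t} = (\<integral>\<^sup>+x. ennreal (indicator {-s..s} x / phi x) * indicator {-t..t} x \<partial>lborel)"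
    unfolding weight_def by (rule emeasure_density) auto
  also have "\<dots> \<le> (\<integral>\<^sup>+x. ennreal (1 / phi t) * indicator {-t..t} x \<partial>lborel)"
  proof (intro nn_integral_mono)
    fix x
    have "1 / phi x \<le> 1 / phi t" if "x \<in> {-t..t}"
      using phi_mono_abs[of x t] that phi_pos[of x] phi_pos[of t] by (intro divide_left_mono) auto
    then show "ennreal (indicator {-s..s} x / phi x) * indicator {-t..t} x \<le> ennreal (1 / phi t) * indicator {-t..t} x"
      using phi_pos[of t] by (auto split: split_indicator intro!: ennreal_leI)
  qed
  also have "\<dots> = ennreal (1 / phi t) * ennreal (2 * t)"
    using assms by (subst nn_integral_cmult) auto
  also have "\<dots> = ennreal (2 * t / phi t)"
    using assms phi_pos[of t] by (simp flip: ennreal_mult)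
  finally show ?thesis .
qed

lemma emeasure_weight_UNIV: "emeasure (weight s) UNIV = emeasure (weight s) {-s..s}"
  unfolding weight_def by (subst (1 2) emeasure_density) (auto intro!: nn_integral_cong split: split_indicator)

lemma finite_measure_weight: "0 \<le> s \<Longrightarrow> finite_measure (weight s)"
  using emeasure_weight_Icc[of s s]
  by (intro finite_measureI) (auto simp: emeasure_weight_UNIV top_unique)

lemma measure_weight_Icc:
  assumes "0 \<le> s" "0 \<le> t" shows "measure (weight s) {-t..t} \<le> 2 * t / phi t"
proof -
  interpret finite_measure "weight s" by (rule finite_measure_weight) fact
  show ?thesis
    using emeasure_weight_Icc[OF assms(2), of s] assms phi_pos[of t] by (simp add: emeasure_eq_measure)
qed

lemma measure_weight_UNIV: "0 \<le> s \<Longrightarrow> measure (weight s) UNIV \<le> 2 * s / phi s"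
  using measure_weight_Icc[of s s] by (simp add: measure_def emeasure_weight_UNIV)

lemma integrable_weight:
  assumes "0 \<le> s" "f \<in> borel_measurable borel" "\<And>x. \<bar>f x\<bar> \<le> (C::real)"
  shows "integrable (weight s) f"
  using assms
  by (intro finite_measure.integrable_const_bound[OF finite_measure_weight, of s f C]) auto

lemma abs_var_le_1: "\<bar>Phi x * (1 - Phi x)\<bar> \<le> 1"
  using var_le_tail_min[of x] tail_min_le_1[of x] Phi_pos[of x] Phi_less_1[of x] by simp

text \<open>For |y| \<le> |x| the squared covariance is at most (tail_min x)^2, and these y have
  weight at most 2 * |x| / phi x. By Mills' inequality the inner integral is then at most 2 *
  tail_min x, hence at most four times the variance; the half-plane |x| \<le> |y| doubles the
  result. Linearity in \<open>var_integral\<close> is the point, since the square of the mean is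
  quadratic.\<close>

lemma cov_sq_integral_le:
  assumes s: "0 \<le> s"
  shows "(\<integral>x. (\<integral>y. (Phi (min x y) - Phi x * Phi y)\<^sup>2 \<partial>weight s) \<partial>weight s) \<le> 8 * var_integral s"
proof -
  interpret W: finite_measure "weight s" by (rule finite_measure_weight) fact
  define k where "k x y = (tail_min x)\<^sup>2 * of_bool (\<bar>y\<bar> \<le> \<bar>x\<bar>)" for x y
  have km: "(\<lambda>z. k (fst z) (snd z)) \<in> borel_measurable (borel \<Otimes>\<^sub>M borel)"
    unfolding k_def of_bool_def by measurable
  have t1: "(tail_min x)\<^sup>2 \<le> 1" for x
    using tail_min_le_1[of x] tail_min_pos[of x] by (simp add: abs_square_le_1)
  have kb: "\<bar>k x y\<bar> \<le> 1" for x y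
    using t1[of x] by (simp add: k_def)
  have ki: "integrable (weight s) (k x)" "integrable (weight s) (\<lambda>y. k y x)" for x
    by (rule integrable_weight[OF s _ kb]; (simp add: k_def of_bool_def))+
  have fub: "integrable (weight s) (\<lambda>x. \<integral>y. k x y \<partial>weight s)" "integrable (weight s) (\<lambda>y. \<integral>x. k x y \<partial>weight s)"
     "(\<integral>x. (\<integral>y. k x y \<partial>weight s) \<partial>weight s) = (\<integral>y. (\<integral>x. k x y \<partial>weight s) \<partial>weight s)"
    using km by (intro Fubini_bounded[OF finite_measure_weight[OF s] finite_measure_weight[OF s] _ kb]; simp)+
  have tm: "integrable (weight s) tail_min"
    using tail_min_le_1 tail_min_pos by (intro integrable_weight[OF s, of _ 1]) (auto simp: less_imp_le)
  have vi: "integrable (weight s) (\<lambda>x. Phi x * (1 - Phi x))"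
    by (intro integrable_weight[OF s _ abs_var_le_1]) auto
  have in1: "(\<integral>y. k x y \<partial>weight s) \<le> 2 * tail_min x" for x
  proof -
    have "(\<integral>y. k x y \<partial>weight s) = (tail_min x)\<^sup>2 * measure (weight s) {- \<bar>x\<bar>..\<bar>x\<bar>}"
    proof -
      have "(\<integral>y. k x y \<partial>weight s) = (\<integral>y. (tail_min x)\<^sup>2 * indicator {- \<bar>x\<bar>..\<bar>x\<bar>} y \<partial>weight s)"
        by (intro Bochner_Integration.integral_cong) (auto simp: k_def indicator_def)
      then show ?thesis by simp
    qed
    also have "\<dots> \<le> (tail_min x)\<^sup>2 * (2 * \<bar>x\<bar> / phi \<bar>x\<bar>)"
      using measure_weight_Icc[OF s, of "\<bar>x\<bar>"] by (intro mult_left_mono) auto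
    also have "\<dots> = 2 * tail_min x * ((\<bar>x\<bar> * tail_min x) / phi x)"
      by (auto simp: power2_eq_square abs_if phi_minus)
    also have "\<dots> \<le> 2 * tail_min x * 1"
      using abs_mult_tail_min[of x] phi_pos[of x] tail_min_pos[of x] by (intro mult_left_mono) auto
    finally show ?thesis by simp
  qed
  have K: "(\<integral>x. (\<integral>y. k x y \<partial>weight s) \<partial>weight s) \<le> 4 * var_integral s"
  proof -
    have "(\<integral>x. (\<integral>y. k x y \<partial>weight s) \<partial>weight s) \<le> (\<integral>x. 4 * (Phi x * (1 - Phi x)) \<partial>weight s)"
      using fub(1) vi
    proof (intro integral_mono)
      fix x
      show "(\<integral>y. k x y \<partial>weight s) \<le> 4 * (Phi x * (1 - Phi x))"
        using in1[of x] tail_min_le_var[of x] by linarith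
    qed auto
    then show ?thesis by (simp add: var_integral_def)
  qed
  \<comment> \<open>The larger of |x| and |y| decides which kernel dominates; adding both avoids
    splitting the domain of integration.\<close>
  have c: "(Phi (min x y) - Phi x * Phi y)\<^sup>2 \<le> k x y + k y x" for x y
  proof (cases "\<bar>y\<bar> \<le> \<bar>x\<bar>")
    case True
    have "0 \<le> k y x" by (simp add: k_def)
    then show ?thesis using Phi_cov_sq_le[OF True] True unfolding k_def[of x y] by (simp add: tail_min_def)
  next
    case False
    then show ?thesis using Phi_cov_sq_le[of x y] by (simp add: k_def tail_min_def min.commute mult.commute)
  qed
  have cb: "\<bar>(Phi (min x y) - Phi x * Phi y)\<^sup>2\<bar> \<le> 2" for x y
    using c[of x y] kb[of x y] kb[of y x] by (simp add: abs_le_iff)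
  have cm: "(\<lambda>z. (Phi (min (fst z) (snd z)) - Phi (fst z) * Phi (snd z))\<^sup>2) \<in> borel_measurable (weight s \<Otimes>\<^sub>M weight s)"
    by measurable
  have "(\<integral>x. (\<integral>y. (Phi (min x y) - Phi x * Phi y)\<^sup>2 \<partial>weight s) \<partial>weight s)
      \<le> (\<integral>x. (\<integral>y. k x y \<partial>weight s) + (\<integral>y. k y x \<partial>weight s) \<partial>weight s)"
  proof (intro integral_mono)
    show "integrable (weight s) (\<lambda>x. \<integral>y. (Phi (min x y) - Phi x * Phi y)\<^sup>2 \<partial>weight s)"
      by (rule Fubini_bounded(1)[OF finite_measure_weight[OF s] finite_measure_weight[OF s] cm cb])
    show "integrable (weight s) (\<lambda>x. (\<integral>y. k x y \<partial>weight s) + (\<integral>y. k y x \<partial>weight s))"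
      using fub by simp
    fix x
    have "(\<integral>y. (Phi (min x y) - Phi x * Phi y)\<^sup>2 \<partial>weight s) \<le> (\<integral>y. k x y + k y x \<partial>weight s)"
      using ki c by (intro integral_mono integrable_weight[OF s _ cb]) auto
    then show "(\<integral>y. (Phi (min x y) - Phi x * Phi y)\<^sup>2 \<partial>weight s) \<le> (\<integral>y. k x y \<partial>weight s) + (\<integral>y. k y x \<partial>weight s)"
      using ki by simp
  qed
  also have "\<dots> = (\<integral>x. (\<integral>y. k x y \<partial>weight s) \<partial>weight s) + (\<integral>x. (\<integral>y. k y x \<partial>weight s) \<partial>weight s)"
    using fub by simp
  also have "\<dots> \<le> 8 * var_integral s" using K fub(3) by simp
  finally show ?thesis .
qed

text \<open>The primitive - phi y / y has derivative phi y * (1 + 1 / y^2), and 1 / y^2 \<le> 1 /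
  x^2 on the tail.\<close>

lemma mills_lower: assumes "0 < x" shows "phi x / x \<le> (1 + 1 / x\<^sup>2) * (1 - Phi x)"
proof -
  have lim: "((\<lambda>y. - (phi y / y)) \<longlongrightarrow> 0) at_top"
    unfolding std_normal_density_def by real_asymp
  have d: "DERIV (\<lambda>y. - (phi y / y)) y :> phi y * (1 + 1 / y\<^sup>2)" if "x \<le> y" for y
    using assms that by (auto intro!: derivative_eq_intros DERIV_phi simp: field_simps power2_eq_square)
  have "ennreal (0 - - (phi x / x)) = (\<integral>\<^sup>+y. ennreal (phi y * (1 + 1 / y\<^sup>2)) * indicator {x..} y \<partial>lborel)"
    using d lim by (intro nn_integral_FTC_atLeast[symmetric]) auto
  also have "\<dots> \<le> (\<integral>\<^sup>+y. ennreal (1 + 1 / x\<^sup>2) * (ennreal (phi y) * indicator {x..} y) \<partial>lborel)"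
  proof (intro nn_integral_mono)
    fix y
    have "phi y * (1 + 1 / y\<^sup>2) \<le> (1 + 1 / x\<^sup>2) * phi y" if "x \<le> y"
      using assms that by (subst mult.commute) (auto intro!: mult_right_mono divide_left_mono power_mono)
    then show "ennreal (phi y * (1 + 1 / y\<^sup>2)) * indicator {x..} y \<le> ennreal (1 + 1 / x\<^sup>2) * (ennreal (phi y) * indicator {x..} y)"
      by (auto split: split_indicator intro!: ennreal_leI simp del: ennreal_plus simp flip: ennreal_mult)
  qed
  also have "\<dots> = ennreal ((1 + 1 / x\<^sup>2) * (1 - Phi x))"
    using Phi_less_1[of x] by (subst nn_integral_cmult) (auto simp: nn_integral_phi_tail ennreal_mult)
  finally show ?thesis using Phi_less_1[of x] by (simp add: less_imp_le)
qed

lemma mills_asymp: "((\<lambda>x. x * (1 - Phi x) / phi x) \<longlongrightarrow> 1) at_top"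
proof (rule tendsto_sandwich)
  show "\<forall>\<^sub>F x in at_top. 1 / (1 + 1 / x\<^sup>2) \<le> x * (1 - Phi x) / phi x"
    using eventually_gt_at_top[of 0]
  proof eventually_elim
    case (elim x)
    have "0 < 1 + 1 / x\<^sup>2" by (simp add: add_pos_nonneg)
    then show ?case using mills_lower[OF elim] phi_pos[of x] elim by (simp add: divide_simps mult.commute)
  qed
  show "\<forall>\<^sub>F x in at_top. x * (1 - Phi x) / phi x \<le> 1"
    using mills_upper phi_pos by (simp add: divide_le_eq_1_pos)
  show "((\<lambda>x::real. 1 / (1 + 1 / x\<^sup>2)) \<longlongrightarrow> 1) at_top" by real_asymp
qed simp

text \<open>By evenness the derivative in s is 2 * k s, and s * k s tends to 1 by the Mills
  asymptotics; L'Hospital's rule then compares with 2 * ln s.\<close>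

lemma var_integral_asymp: "((\<lambda>s. var_integral s / (2 * ln s)) \<longlongrightarrow> 1) at_top"
proof -
  define k where "k x = Phi x * (1 - Phi x) / phi x" for x
  have kc: "isCont k x" for x
    unfolding k_def using DERIV_isCont[OF DERIV_phi, of x] isCont_Phi[of x] phi_pos[of x] by (intro continuous_intros) auto
  have km [measurable]: "k \<in> borel_measurable borel"
    unfolding k_def[abs_def] by measurable
  \<comment> \<open>An antiderivative on the whole line makes the integral over the varying interval
    \<open>{-s..s}\<close> differentiable in s.\<close>
  obtain F where F: "\<And>x. DERIV F x :> k x"
    using einterval_antiderivative[of "-\<infinity>" "\<infinity>" k] kc by (auto simp: has_real_derivative_iff_has_vector_derivative)
  have J: "var_integral s = F s - F (- s)" if "0 \<le> s" for s
  proof -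
    have "var_integral s = (\<integral>x. indicator {-s..s} x / phi x * (Phi x * (1 - Phi x)) \<partial>lborel)"
      unfolding var_integral_def weight_def by (subst integral_real_density) (auto simp: less_imp_le[OF phi_pos])
    also have "\<dots> = (\<integral>x. k x * indicator {-s..s} x \<partial>lborel)"
      by (intro Bochner_Integration.integral_cong) (auto simp: k_def indicator_def)
    also have "\<dots> = F s - F (- s)"
      using that Phi_pos Phi_less_1 by (intro integral_FTC_Icc_nonneg F) (auto simp: k_def less_imp_le)
    finally show ?thesis .
  qed
  have km: "k (- x) = k x" for x by (simp add: k_def Phi_minus phi_minus)
  have dF: "DERIV (\<lambda>s. F s - F (- s)) s :> 2 * k s" for s
    by (rule DERIV_cong, rule DERIV_diff[OF F DERIV_chain2[OF F]]) (auto intro!: derivative_eq_intros simp: km)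
  have "((\<lambda>s. (F s - F (- s)) / (2 * ln s)) \<longlongrightarrow> 1) at_top"
  proof (rule lhospital_at_top_at_top)
    show "LIM s at_top. 2 * ln (s::real) :> at_top" by real_asymp
    show "\<forall>\<^sub>F s in at_top. (2::real) / s \<noteq> 0" using eventually_gt_at_top[of 0] by eventually_elim auto
    show "\<forall>\<^sub>F s in at_top. DERIV (\<lambda>s. F s - F (- s)) s :> 2 * k s" using dF by simp
    show "\<forall>\<^sub>F s in at_top. DERIV (\<lambda>s. 2 * ln s) (s::real) :> 2 / s"
      using eventually_gt_at_top[of 0] by eventually_elim (auto intro!: derivative_eq_intros)
    have "((\<lambda>s. Phi s * (s * (1 - Phi s) / phi s)) \<longlongrightarrow> 1 * 1) at_top"
      by (intro tendsto_mult Phi_tendsto_1 mills_asymp)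
    moreover have "2 * k s / (2 / s) = Phi s * (s * (1 - Phi s) / phi s)" for s
    proof -
      have "2 * k s / (2 / s) = s * k s" by simp
      then show ?thesis by (simp add: k_def mult_ac)
    qed
    ultimately show "((\<lambda>s. 2 * k s / (2 / s)) \<longlongrightarrow> 1) at_top" by simp
  qed
  then show ?thesis
  proof (rule Lim_transform_eventually)
    show "\<forall>\<^sub>F s in at_top. (F s - F (- s)) / (2 * ln s) = var_integral s / (2 * ln s)"
      using eventually_ge_at_top[of 0] by eventually_elim (simp add: J)
  qed
qed

section \<open>Upper and lower bounds\<close>

text \<open>The right side integrates only the positive part of f, because \<open>ennreal\<close>
  drops the negative values.\<close>

lemma ennreal_integral_le_nn_integral:
  fixes f :: "'a \<Rightarrow> real" assumes "integrable M f"
  shows "ennreal (\<integral>x. f x \<partial>M) \<le> (\<integral>\<^sup>+x. ennreal (f x) \<partial>M)"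
proof -
  have "(\<integral>x. f x \<partial>M) \<le> (\<integral>x. max 0 (f x) \<partial>M)"
    using assms by (intro integral_mono) auto
  then have "ennreal (\<integral>x. f x \<partial>M) \<le> ennreal (\<integral>x. max 0 (f x) \<partial>M)" by (rule ennreal_leI)
  also have "\<dots> = (\<integral>\<^sup>+x. ennreal (max 0 (f x)) \<partial>M)"
    using assms by (intro nn_integral_eq_integral[symmetric]) auto
  also have "\<dots> = (\<integral>\<^sup>+x. ennreal (f x) \<partial>M)"
    by (intro nn_integral_cong) (auto simp: max_def ennreal_neg)
  finally show ?thesis .
qed

context iid_std_normal begin

abbreviation Fn :: "nat \<Rightarrow> 'a \<Rightarrow> real \<Rightarrow> real" where "Fn \<equiv> empirical_cdf X"

definition bregman_int :: "nat \<Rightarrow> 'a \<Rightarrow> ennreal" where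
  "bregman_int n \<omega> = (\<integral>\<^sup>+x. bregman x (Fn n \<omega> x) \<partial>lborel)"

lemma measurable_bregman_Fn:
  "(\<lambda>z. bregman (snd z) (Fn n (fst z) (snd z))) \<in> borel_measurable (M \<Otimes>\<^sub>M borel)"
proof -
  have "(\<lambda>z. (snd z, Fn n (fst z) (snd z))) \<in> measurable (M \<Otimes>\<^sub>M borel) (borel \<Otimes>\<^sub>M borel)"
    using measurable_empirical_cdf by (intro measurable_Pair) auto
  from measurable_compose[OF this borel_measurable_bregman] show ?thesis by simp
qed

lemma measurable_dev1: "dev n x \<in> borel_measurable M"
  using measurable_compose[OF measurable_Pair2'[of x borel M] measurable_dev] by simp

lemma measurable_bregman_int [measurable]: "bregman_int n \<in> borel_measurable M"
  unfolding bregman_int_def using measurable_bregman_Fn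
  by (intro lborel.borel_measurable_nn_integral) (simp add: split_beta')

lemma W2_sq_Fn: "1 \<le> n \<Longrightarrow> (W2 (Fn n \<omega>) Phi)\<^sup>2 = enn2real (2 * bregman_int n \<omega>)"
  unfolding bregman_int_def by (rule W2_sq_eq[OF right_continuous_mono_empirical_cdf])

lemma W2_Fn_nonneg: "0 \<le> W2 (Fn n \<omega>) Phi"
  unfolding W2_def set_lebesgue_integral_def by (intro real_sqrt_ge_zero integral_nonneg_AE) auto

text \<open>By the Bregman representation this is a square root of a measurable function, so no
  joint measurability of the quantiles in u and \<omega> has to be established.\<close>

lemma measurable_W2: "1 \<le> n \<Longrightarrow> (\<lambda>\<omega>. W2 (Fn n \<omega>) Phi) \<in> borel_measurable M"
proof -
  assume n: "1 \<le> n"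
  have "(\<lambda>\<omega>. sqrt (enn2real (2 * bregman_int n \<omega>))) \<in> borel_measurable M" by measurable
  then show ?thesis
    using n by (simp add: W2_Fn_nonneg flip: W2_sq_Fn)
qed

section \<open>Expected divergence in the inner, middle and outer regions\<close>

lemma integrable_bounded_dev:
  assumes [measurable]: "f \<in> borel_measurable borel" and "\<And>t. \<bar>t\<bar> \<le> 1 \<Longrightarrow> \<bar>f t\<bar> \<le> (C::real)"
  shows "integrable M (\<lambda>\<omega>. f (dev n x \<omega>))"
proof -
  note [measurable] = measurable_dev1
  show ?thesis using assms(2) abs_G_le_1 by (intro integrable_const_bound[where B=C]) auto
qed

text \<open>Interpolation between the second and fourth moments: |t|^3 \<le> (t^2 / sqrt n + sqrt n
  * t^4) / 2, where the factor sqrt n balances moments of order 1 / n and 1 / n^2. As the variance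
  is at most 1 / (4 * n), the fourth moment is at most 2 / n^2.\<close>

lemma dev_third_moment:
  assumes n: "1 \<le> n" shows "expectation (\<lambda>\<omega>. \<bar>dev n x \<omega>\<bar> ^ 3) \<le> 2 / (n * sqrt n)"
proof -
  have n0: "0 < real n" using n by simp
  have i2: "integrable M (\<lambda>\<omega>. (dev n x \<omega>)\<^sup>2)"
    by (rule integrable_bounded_dev[where C=1]) (auto simp: abs_square_le_1)
  have i3: "integrable M (\<lambda>\<omega>. \<bar>dev n x \<omega>\<bar> ^ 3)"
    by (rule integrable_bounded_dev[where C=1]) (auto simp: power_le_one)
  have i4: "integrable M (\<lambda>\<omega>. (dev n x \<omega>)\<^sup>2 * (dev n x \<omega>)\<^sup>2)"
  proof (rule integrable_bounded_dev[where C=1])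
    show "\<bar>t\<^sup>2 * t\<^sup>2\<bar> \<le> 1" if "\<bar>t\<bar> \<le> 1" for t :: real
      using power_le_one[of "\<bar>t\<bar>" 4] that by simp
  qed simp
  have pt: "\<bar>t\<bar> ^ 3 \<le> (1 / sqrt n * t\<^sup>2 + sqrt n * (t\<^sup>2 * t\<^sup>2)) / 2" for t :: real
  proof -
    have "0 \<le> t\<^sup>2 / sqrt n * (1 - sqrt n * \<bar>t\<bar>)\<^sup>2" by simp
    also have "\<dots> = 1 / sqrt n * t\<^sup>2 + sqrt n * (t\<^sup>2 * t\<^sup>2) - 2 * \<bar>t\<bar> ^ 3"
      using n0 by (auto simp: field_simps power2_eq_square power3_eq_cube abs_if)
    finally show ?thesis by simp
  qed
  have v: "0 \<le> Phi x * (1 - Phi x)" "Phi x * (1 - Phi x) \<le> 1"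
    using abs_var_le_1[of x] Phi_pos[of x] Phi_less_1[of x] by (auto simp: less_imp_le)
  have v2: "Phi x * (1 - Phi x) \<le> 1 / 4"
    using zero_le_power2[of "Phi x - 1 / 2"] by (simp add: power2_eq_square algebra_simps)
  have "expectation (\<lambda>\<omega>. (dev n x \<omega>)\<^sup>2 * (dev n x \<omega>)\<^sup>2)
     \<le> (Phi x * (1 - Phi x) * (Phi x * (1 - Phi x)) + 2 * (Phi x * (1 - Phi x))\<^sup>2) / (real n)\<^sup>2 + 1 / real n ^ 3"
    using dev_moments(3)[OF n, of x x] by (simp add: algebra_simps)
  also have "\<dots> = 3 * (Phi x * (1 - Phi x))\<^sup>2 / (real n)\<^sup>2 + 1 / real n ^ 3"
    by (simp add: power2_eq_square)
  also have "\<dots> \<le> 1 / (real n)\<^sup>2 + 1 / real n ^ 2"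
  proof (intro add_mono divide_right_mono divide_left_mono)
    have "(Phi x * (1 - Phi x))\<^sup>2 \<le> (1 / 4)\<^sup>2" using v v2 by (intro power_mono) auto
    then show "3 * (Phi x * (1 - Phi x))\<^sup>2 \<le> 1" by (simp add: power2_eq_square)
    show "real n ^ 2 \<le> real n ^ 3" using n by (intro power_increasing) auto
  qed (use n0 in auto)
  finally have e4: "expectation (\<lambda>\<omega>. (dev n x \<omega>)\<^sup>2 * (dev n x \<omega>)\<^sup>2) \<le> 2 / (real n)\<^sup>2" by simp
  have "expectation (\<lambda>\<omega>. \<bar>dev n x \<omega>\<bar> ^ 3) \<le> expectation (\<lambda>\<omega>. (1 / sqrt n * (dev n x \<omega>)\<^sup>2 + sqrt n * ((dev n x \<omega>)\<^sup>2 * (dev n x \<omega>)\<^sup>2)) / 2)"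
    using i2 i3 i4 pt by (intro integral_mono) auto
  also have "\<dots> = (1 / sqrt n * (Phi x * (1 - Phi x) / n) + sqrt n * expectation (\<lambda>\<omega>. (dev n x \<omega>)\<^sup>2 * (dev n x \<omega>)\<^sup>2)) / 2"
    using i2 i4 n by (simp add: dev_moments)
  also have "\<dots> \<le> (1 / sqrt n * (1 / n) + sqrt n * (2 / (real n)\<^sup>2)) / 2"
    using v n0 e4 by (intro divide_right_mono add_mono mult_left_mono) auto
  also have "sqrt n * (2 / (real n)\<^sup>2) = 2 * (1 / sqrt n * (1 / n))"
    using n0 by (simp add: field_simps power2_eq_square)
  also have "(1 / sqrt n * (1 / n) + 2 * (1 / sqrt n * (1 / n))) / 2 \<le> 2 / (n * sqrt n)"
    using n0 by (simp add: field_simps)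
  finally show ?thesis .
qed

text \<open>The denominator \<open>tail_min x\<close> is replaced by its least value 1 - Phi s on
  the window, so that the cubic error depends on x only through 1 / phi x.\<close>

lemma expectation_bregman_inner:
  assumes n: "1 \<le> n" and x: "\<bar>x\<bar> \<le> s"
  shows "(\<integral>\<^sup>+\<omega>. bregman x (Fn n \<omega> x) \<partial>M)
     \<le> ennreal ((Phi x * (1 - Phi x) / n + 2 / (n * sqrt n) / (1 - Phi s)) / (2 * phi x))"
proof -
  define m where "m = 1 - Phi s"
  have m: "0 < m" "m \<le> tail_min x" using Phi_less_1[of s] tail_min_mono[OF x] by (auto simp: m_def)
  have i2: "integrable M (\<lambda>\<omega>. (dev n x \<omega>)\<^sup>2)"
    by (rule integrable_bounded_dev[where C=1]) (auto simp: abs_square_le_1)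
  have i3: "integrable M (\<lambda>\<omega>. \<bar>dev n x \<omega>\<bar> ^ 3)"
    by (rule integrable_bounded_dev[where C=1]) (auto simp: power_le_one)
  have "(\<integral>\<^sup>+\<omega>. bregman x (Fn n \<omega> x) \<partial>M) \<le> (\<integral>\<^sup>+\<omega>. ennreal (((dev n x \<omega>)\<^sup>2 + \<bar>dev n x \<omega>\<bar> ^ 3 / m) / (2 * phi x)) \<partial>M)"
  proof (intro nn_integral_mono)
    fix \<omega>
    have "\<bar>dev n x \<omega>\<bar> ^ 3 / tail_min x \<le> \<bar>dev n x \<omega>\<bar> ^ 3 / m"
      using m by (intro divide_left_mono) auto
    then have "ennreal (((dev n x \<omega>)\<^sup>2 + \<bar>dev n x \<omega>\<bar> ^ 3 / tail_min x) / (2 * phi x)) \<le> ennreal (((dev n x \<omega>)\<^sup>2 + \<bar>dev n x \<omega>\<bar> ^ 3 / m) / (2 * phi x))"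
      using phi_pos[of x] by (intro ennreal_leI divide_right_mono) auto
    then show "bregman x (Fn n \<omega> x) \<le> ennreal (((dev n x \<omega>)\<^sup>2 + \<bar>dev n x \<omega>\<bar> ^ 3 / m) / (2 * phi x))"
      using bregman_upper[OF empirical_cdf_bounds[of n \<omega> x], of x] unfolding dev_def tail_min_def by simp
  qed
  also have "\<dots> = ennreal (expectation (\<lambda>\<omega>. ((dev n x \<omega>)\<^sup>2 + \<bar>dev n x \<omega>\<bar> ^ 3 / m) / (2 * phi x)))"
    using i2 i3 m phi_pos[of x] by (intro nn_integral_eq_integral) auto
  also have "\<dots> \<le> ennreal ((Phi x * (1 - Phi x) / n + 2 / (n * sqrt n) / m) / (2 * phi x))"
    using i2 i3 m phi_pos[of x] divide_right_mono[OF dev_third_moment[OF n, of x], of m]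
    by (intro ennreal_leI) (auto simp: dev_moments[OF n] intro!: divide_right_mono)
  finally show ?thesis by (simp add: m_def)
qed

text \<open>Variance over phi is at most 1 / |x|. Integrated over an interval of length 2 * r this
  costs 2 * r / (n * s), of order 1 / n when r / s is bounded.\<close>

lemma expectation_bregman_middle:
  assumes n: "1 \<le> n" and s: "0 < s" and x: "s \<le> \<bar>x\<bar>"
  shows "(\<integral>\<^sup>+\<omega>. bregman x (Fn n \<omega> x) \<partial>M) \<le> ennreal (1 / (n * s))"
proof -
  have i2: "integrable M (\<lambda>\<omega>. (dev n x \<omega>)\<^sup>2)"
    by (rule integrable_bounded_dev[where C=1]) (auto simp: abs_square_le_1)
  have "(\<integral>\<^sup>+\<omega>. bregman x (Fn n \<omega> x) \<partial>M) \<le> (\<integral>\<^sup>+\<omega>. ennreal ((dev n x \<omega>)\<^sup>2 / phi x) \<partial>M)"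
    using bregman_le_sq[OF empirical_cdf_bounds] by (intro nn_integral_mono) (simp add: dev_def)
  also have "\<dots> = ennreal (Phi x * (1 - Phi x) / n / phi x)"
    using i2 phi_pos[of x] by (subst nn_integral_eq_integral) (auto simp: dev_moments[OF n])
  also have "\<dots> \<le> ennreal (1 / (n * s))"
  proof (rule ennreal_leI)
    have "s * (Phi x * (1 - Phi x)) \<le> \<bar>x\<bar> * tail_min x"
      using s x var_le_tail_min[of x] Phi_pos[of x] Phi_less_1[of x] by (intro mult_mono) auto
    also have "\<dots> \<le> phi x" by (rule abs_mult_tail_min)
    finally show "Phi x * (1 - Phi x) / n / phi x \<le> 1 / (n * s)"
      using s phi_pos[of x] n by (simp add: divide_simps mult.commute)
  qed
  finally show ?thesis .
qed

text \<open>Since \<open>I q \<ge> 0\<close>, \<open>D (x, q) \<le> I p + I' p * (q - p)\<close>, and \<open>E q = p\<close>.\<close>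
lemma expectation_bregman_outer:
  assumes n: "1 \<le> n"
  shows "(\<integral>\<^sup>+\<omega>. bregman x (Fn n \<omega> x) \<partial>M) \<le> ennreal (phi x)"
proof -
  have i1: "integrable M (dev n x)"
    using integrable_bounded_dev[of "\<lambda>t. t" 1 n x] by simp
  \<comment> \<open>The affine bound is a convex combination, with weights F_n x and 1 - F_n x, of
    two quantities that are nonnegative by Mills' inequality; hence \<open>ennreal\<close> cuts
    nothing off and only the mean of F_n x matters.\<close>
  have nn: "0 \<le> phi x - x * dev n x \<omega>" for \<omega>
  proof -
    have "0 \<le> phi x - x * (1 - Phi x)" "0 \<le> phi x + x * Phi x"
      using mills_upper[of x] mills_upper[of "- x"] by (auto simp: phi_minus Phi_minus)
    then have "0 \<le> Fn n \<omega> x * (phi x - x * (1 - Phi x)) + (1 - Fn n \<omega> x) * (phi x + x * Phi x)"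
      by (intro add_nonneg_nonneg[OF mult_nonneg_nonneg mult_nonneg_nonneg]) (simp_all add: empirical_cdf_bounds)
    also have "\<dots> = phi x - x * dev n x \<omega>"
      unfolding dev_def by (simp add: algebra_simps)
    finally show ?thesis .
  qed
  have "(\<integral>\<^sup>+\<omega>. bregman x (Fn n \<omega> x) \<partial>M) \<le> (\<integral>\<^sup>+\<omega>. ennreal (phi x - x * dev n x \<omega>) \<partial>M)"
    using bregman_le_affine[OF empirical_cdf_bounds] by (intro nn_integral_mono) (simp add: dev_def)
  also have "\<dots> = ennreal (expectation (\<lambda>\<omega>. phi x - x * dev n x \<omega>))"
    by (intro nn_integral_eq_integral AE_I2 nn Bochner_Integration.integrable_diff integrable_mult_right i1) simp
  also have "\<dots> = ennreal (phi x)"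
    using i1 by (simp add: dev_moments[OF n] prob_space)
  finally show ?thesis .
qed

text \<open>The line is cut at |x| = s and |x| = r, and each piece gets its own bound. The doubling
  in W2^2 turns the middle cost 2 * r / (n * s) and the two outer tails 1 - Phi r into the terms
  with factor 4.\<close>

lemma expectation_bregman_int_upper:
  assumes n: "1 \<le> n" and s: "0 < s" and r: "s \<le> r"
  shows "(\<integral>\<^sup>+\<omega>. 2 * bregman_int n \<omega> \<partial>M) \<le> ennreal ((var_integral s
    + 4 * s / (phi s * sqrt n * (1 - Phi s)) + 4 * r / s + 4 * real n * (1 - Phi r)) / n)"
proof -
  define c where "c = 2 / (n * sqrt n) / (1 - Phi s)"
  have c: "0 \<le> c" using Phi_less_1[of s] by (simp add: c_def)
  define h1 where "h1 x = (Phi x * (1 - Phi x) / n + c) / 2" for x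
  have h1: "0 \<le> h1 x" for x using c Phi_pos[of x] Phi_less_1[of x] by (simp add: h1_def less_imp_le)
  have h1m [measurable]: "h1 \<in> borel_measurable borel" unfolding h1_def[abs_def] by measurable
  note [measurable] = measurable_bregman_Fn
  have "(\<integral>\<^sup>+\<omega>. bregman_int n \<omega> \<partial>M) = (\<integral>\<^sup>+x. (\<integral>\<^sup>+\<omega>. bregman x (Fn n \<omega> x) \<partial>M) \<partial>lborel)"
  proof -
    interpret P: pair_sigma_finite M lborel by standard
    show ?thesis unfolding bregman_int_def by (rule P.Fubini'[symmetric]) (simp add: split_beta' measurable_bregman_Fn)
  qed
  \<comment> \<open>The majorant is the sum of the regional bounds. The regions overlap, the middle
    term covering all of \<open>{-r..r}\<close>, which is harmless for an upper bound and makes each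
    integral elementary.\<close>
  also have "\<dots> \<le> (\<integral>\<^sup>+x. (ennreal (indicator {-s..s} x / phi x) * ennreal (h1 x) + ennreal (1 / (n * s)) * indicator {-r..r} x)
      + (ennreal (phi x) * indicator {r..} x + ennreal (phi x) * indicator {..-r} x) \<partial>lborel)"
  proof (intro nn_integral_mono)
    fix x :: real
    consider "\<bar>x\<bar> \<le> s" | "s < \<bar>x\<bar>" "\<bar>x\<bar> \<le> r" | "r < \<bar>x\<bar>" by linarith
    then show "(\<integral>\<^sup>+\<omega>. bregman x (Fn n \<omega> x) \<partial>M) \<le> (ennreal (indicator {-s..s} x / phi x) * ennreal (h1 x) + ennreal (1 / (n * s)) * indicator {-r..r} x)
      + (ennreal (phi x) * indicator {r..} x + ennreal (phi x) * indicator {..-r} x)"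
    proof cases
      case 1
      have "(\<integral>\<^sup>+\<omega>. bregman x (Fn n \<omega> x) \<partial>M) \<le> ennreal (1 / phi x) * ennreal (h1 x)"
        using expectation_bregman_inner[OF n 1] h1[of x] phi_pos[of x]
        by (simp add: h1_def c_def mult.commute flip: ennreal_mult)
      moreover have "indicator {-s..s} x = (1::real)" using 1 by (simp add: abs_le_iff)
      ultimately show ?thesis by (auto intro!: add_increasing2)
    next
      case 2
      then have "(\<integral>\<^sup>+\<omega>. bregman x (Fn n \<omega> x) \<partial>M) \<le> ennreal (1 / (n * s)) * indicator {-r..r} x"
        using expectation_bregman_middle[OF n s, of x] by (simp add: abs_le_iff)
      then show ?thesis by (intro add_increasing2 add_increasing) auto
    next
      case 3
      then have "(\<integral>\<^sup>+\<omega>. bregman x (Fn n \<omega> x) \<partial>M) \<le> ennreal (phi x) * indicator {r..} x + ennreal (phi x) * indicator {..-r} x"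
        using expectation_bregman_outer[OF n, of x] s r by (auto simp: indicator_def abs_if split: if_splits)
      then show ?thesis by (rule add_increasing[OF zero_le])
    qed
  qed
  also have "\<dots> = (\<integral>\<^sup>+x. ennreal (h1 x) \<partial>weight s) + (\<integral>\<^sup>+x. ennreal (1 / (n * s)) * indicator {-r..r} x \<partial>lborel)
      + ((\<integral>\<^sup>+x. ennreal (phi x) * indicator {r..} x \<partial>lborel) + (\<integral>\<^sup>+x. ennreal (phi x) * indicator {..-r} x \<partial>lborel))"
    by (simp add: nn_integral_add nn_integral_weight)
  also have "(\<integral>\<^sup>+x. ennreal (phi x) * indicator {..-r} x \<partial>lborel) = ennreal (1 - Phi r)"
    unfolding nn_integral_phi_tail[symmetric]
    by (subst nn_integral_real_affine[where c="-1" and t=0]) (auto simp: phi_minus indicator_def intro!: nn_integral_cong)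
  also have "(\<integral>\<^sup>+x. ennreal (phi x) * indicator {r..} x \<partial>lborel) = ennreal (1 - Phi r)"
    by (rule nn_integral_phi_tail)
  also have "(\<integral>\<^sup>+x. ennreal (1 / (n * s)) * indicator {-r..r} x \<partial>lborel) = ennreal (1 / (n * s) * (2 * r))"
  proof -
    have "(\<integral>\<^sup>+x. ennreal (1 / (n * s)) * indicator {-r..r} x \<partial>lborel) = ennreal (1 / (n * s)) * ennreal (2 * r)"
      using s r by (subst nn_integral_cmult) auto
    also have "\<dots> = ennreal (1 / (n * s) * (2 * r))"
      using s r by (intro ennreal_mult[symmetric]) auto
    finally show ?thesis .
  qed
  also have "(\<integral>\<^sup>+x. ennreal (h1 x) \<partial>weight s) \<le> ennreal ((var_integral s / n + c * (2 * s / phi s)) / 2)"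
  proof -
    interpret W: finite_measure "weight s" by (rule finite_measure_weight) (use s in auto)
    have iv: "integrable (weight s) (\<lambda>x. Phi x * (1 - Phi x))"
      using s by (intro integrable_weight[OF _ _ abs_var_le_1]) auto
    then have "integrable (weight s) h1" unfolding h1_def[abs_def] by auto
    then have "(\<integral>\<^sup>+x. ennreal (h1 x) \<partial>weight s) = ennreal (\<integral>x. h1 x \<partial>weight s)"
      using h1 by (intro nn_integral_eq_integral) auto
    also have "(\<integral>x. h1 x \<partial>weight s) = (var_integral s / n + c * measure (weight s) UNIV) / 2"
      unfolding h1_def var_integral_def using iv by simp
    also have "\<dots> \<le> (var_integral s / n + c * (2 * s / phi s)) / 2"
      using c s measure_weight_UNIV[of s] by (intro divide_right_mono add_left_mono mult_left_mono) auto
    finally show ?thesis by (simp add: ennreal_leI)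
  qed
  finally have "(\<integral>\<^sup>+\<omega>. bregman_int n \<omega> \<partial>M) \<le> ennreal ((var_integral s / n + c * (2 * s / phi s)) / 2) + ennreal (1 / (n * s) * (2 * r))
     + (ennreal (1 - Phi r) + ennreal (1 - Phi r))"
    by (simp add: add_mono)
  also have "\<dots> = ennreal ((var_integral s / n + c * (2 * s / phi s)) / 2 + 1 / (n * s) * (2 * r) + ((1 - Phi r) + (1 - Phi r)))"
  proof -
    have "0 \<le> var_integral s"
      unfolding var_integral_def using Phi_pos Phi_less_1 by (intro integral_nonneg_AE) (auto simp: less_imp_le)
    then have "0 \<le> (var_integral s / n + c * (2 * s / phi s)) / 2" "0 \<le> 1 / (n * s) * (2 * r)" "0 \<le> 1 - Phi r"
      using c s r phi_pos[of s] Phi_less_1[of r] by auto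
    then show ?thesis by (simp only: ennreal_plus add_nonneg_nonneg)
  qed
  finally have "2 * (\<integral>\<^sup>+\<omega>. bregman_int n \<omega> \<partial>M) \<le> 2 * ennreal ((var_integral s / n + c * (2 * s / phi s)) / 2 + 1 / (n * s) * (2 * r) + ((1 - Phi r) + (1 - Phi r)))"
    by (rule mult_left_mono) simp
  also have "\<dots> = ennreal (2 * ((var_integral s / n + c * (2 * s / phi s)) / 2 + 1 / (n * s) * (2 * r) + ((1 - Phi r) + (1 - Phi r))))"
    by (metis ennreal_mult' ennreal_numeral zero_le_numeral)
  also have "2 * ((var_integral s / n + c * (2 * s / phi s)) / 2 + 1 / (n * s) * (2 * r) + ((1 - Phi r) + (1 - Phi r)))
     = (var_integral s + 4 * s / (phi s * sqrt n * (1 - Phi s)) + 4 * r / s + 4 * real n * (1 - Phi r)) / n"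
    using n s phi_pos[of s] Phi_less_1[of s] by (simp add: c_def field_simps)
  finally show ?thesis by (simp add: nn_integral_cmult)
qed

end

section \<open>Pathwise lower bound and second moment of the weighted square integral\<close>

lemma var_integral_nonneg: "0 \<le> var_integral s"
  unfolding var_integral_def using Phi_pos Phi_less_1 by (intro integral_nonneg_AE) (auto simp: less_imp_le)

text \<open>With \<open>r = sqrt (t / a)\<close> this is \<open>(r - 1)\<^sup>2 * (r + 2) \<ge> 0\<close>.\<close>
lemma sqrt_lower_quadratic:
  fixes a t :: real assumes "0 < a" "0 \<le> t"
  shows "sqrt a / 2 * (3 * (t / a) - (t / a)\<^sup>2) \<le> sqrt t"
proof -
  define r where "r = sqrt (t / a)"
  have r: "0 \<le> r" "r\<^sup>2 = t / a" using assms by (auto simp: r_def)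
  have "0 \<le> (r - 1)\<^sup>2 * (r + 2)" using r by simp
  also have "\<dots> = r ^ 3 - 3 * r + 2" by (simp add: power2_eq_square power3_eq_cube algebra_simps)
  finally have "r * (3 * r - r ^ 3) \<le> r * 2" using r by (intro mult_left_mono) auto
  then have "3 * (t / a) - (t / a)\<^sup>2 \<le> 2 * r"
    unfolding r(2)[symmetric] by (simp add: power2_eq_square power3_eq_cube algebra_simps)
  then have "sqrt a / 2 * (3 * (t / a) - (t / a)\<^sup>2) \<le> sqrt a / 2 * (2 * r)"
    using assms by (intro mult_left_mono) auto
  also have "\<dots> = sqrt t" using assms by (simp add: r_def real_sqrt_divide)
  finally show ?thesis .
qed

lemma ennreal_divide_mult_half:
  assumes "0 < f" shows "ennreal (1 / f) * ennreal d = 2 * ennreal (d / (2 * f))"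
proof -
  have "ennreal (1 / f) * ennreal d = ennreal (1 / f * d)"
    using assms by (subst ennreal_mult') auto
  also have "1 / f * d = 2 * (d / (2 * f))" by simp
  also have "ennreal \<dots> = 2 * ennreal (d / (2 * f))"
    by (subst ennreal_mult') auto
  finally show ?thesis .
qed

context iid_std_normal begin

definition sq_dev :: "nat \<Rightarrow> real \<Rightarrow> 'a \<Rightarrow> real" where
  "sq_dev n s \<omega> = (\<integral>x. (dev n x \<omega>)\<^sup>2 \<partial>weight s)"

text \<open>The remainder of the pathwise lower bound; 1 - Phi s stands for the least value of
  \<open>tail_min\<close> on the window.\<close>

definition cube_dev :: "nat \<Rightarrow> real \<Rightarrow> 'a \<Rightarrow> real" where
  "cube_dev n s \<omega> = (\<integral>x. \<bar>dev n x \<omega>\<bar> ^ 3 \<partial>weight s) / (1 - Phi s)"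

lemma measurable_dev2: "1 \<le> n \<Longrightarrow> (\<lambda>x. dev n x \<omega>) \<in> borel_measurable borel"
proof -
  assume "1 \<le> n"
  then have [measurable]: "empirical_cdf X n \<omega> \<in> borel_measurable borel"
    by (intro borel_measurable_mono right_continuous_mono.mono[OF right_continuous_mono_empirical_cdf])
  show ?thesis unfolding dev_def by measurable
qed

lemma dev_power_le_1: "\<bar>(dev n x \<omega>)\<^sup>2\<bar> \<le> 1" "\<bar>\<bar>dev n x \<omega>\<bar> ^ 3\<bar> \<le> 1"
  using abs_G_le_1[of n x \<omega>] by (auto simp: abs_square_le_1 power_le_one)

lemma integrable_weight_dev:
  assumes "1 \<le> n" "0 \<le> s"
  shows "integrable (weight s) (\<lambda>x. (dev n x \<omega>)\<^sup>2)" "integrable (weight s) (\<lambda>x. \<bar>dev n x \<omega>\<bar> ^ 3)"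
  using measurable_dev2[OF assms(1)] dev_power_le_1
  by (intro integrable_weight[OF assms(2), where C=1]; simp)+

lemma sq_dev_nonneg: "0 \<le> sq_dev n s \<omega>"
  unfolding sq_dev_def by simp

lemma cube_dev_nonneg: "0 \<le> cube_dev n s \<omega>"
  unfolding cube_dev_def using Phi_less_1[of s] by simp

text \<open>\<open>bregman_lower\<close> is integrated over the window and the nonnegative
  contribution outside it is discarded; the factor 2 cancels the 2 in 2 * phi x.\<close>

lemma bregman_int_lower:
  assumes n: "1 \<le> n" and s: "0 \<le> s"
  shows "ennreal (sq_dev n s \<omega> - cube_dev n s \<omega>) \<le> 2 * bregman_int n \<omega>"
proof -
  define m where "m = 1 - Phi s"
  have m: "0 < m" using Phi_less_1[of s] by (simp add: m_def)
  note [measurable] = measurable_dev2[OF n]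
  have bm: "(\<lambda>x. bregman x (Fn n \<omega> x)) \<in> borel_measurable lborel"
  proof -
    have "Fn n \<omega> \<in> borel_measurable borel"
      using n by (intro borel_measurable_mono right_continuous_mono.mono[OF right_continuous_mono_empirical_cdf])
    then show ?thesis
      using measurable_compose[OF _ borel_measurable_bregman, of "\<lambda>x. (x, Fn n \<omega> x)" borel] by simp
  qed
  have "sq_dev n s \<omega> - cube_dev n s \<omega> = (\<integral>x. (dev n x \<omega>)\<^sup>2 - \<bar>dev n x \<omega>\<bar> ^ 3 / m \<partial>weight s)"
    unfolding sq_dev_def cube_dev_def m_def using integrable_weight_dev[OF n s] by simp
  then have "ennreal (sq_dev n s \<omega> - cube_dev n s \<omega>) \<le> (\<integral>\<^sup>+x. ennreal ((dev n x \<omega>)\<^sup>2 - \<bar>dev n x \<omega>\<bar> ^ 3 / m) \<partial>weight s)"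
    using integrable_weight_dev[OF n s] by (simp only:) (intro ennreal_integral_le_nn_integral, simp)
  also have "\<dots> = (\<integral>\<^sup>+x. ennreal (indicator {-s..s} x / phi x) * ennreal ((dev n x \<omega>)\<^sup>2 - \<bar>dev n x \<omega>\<bar> ^ 3 / m) \<partial>lborel)"
    by (rule nn_integral_weight) measurable
  also have "\<dots> \<le> (\<integral>\<^sup>+x. 2 * bregman x (Fn n \<omega> x) \<partial>lborel)"
  proof (intro nn_integral_mono)
    fix x
    show "ennreal (indicator {-s..s} x / phi x) * ennreal ((dev n x \<omega>)\<^sup>2 - \<bar>dev n x \<omega>\<bar> ^ 3 / m) \<le> 2 * bregman x (Fn n \<omega> x)"
    proof (cases "x \<in> {-s..s}")
      case True
      then have mm: "m \<le> tail_min x" unfolding m_def by (intro tail_min_mono) auto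
      have "ennreal (indicator {-s..s} x / phi x) * ennreal ((dev n x \<omega>)\<^sup>2 - \<bar>dev n x \<omega>\<bar> ^ 3 / m)
          = 2 * ennreal (((dev n x \<omega>)\<^sup>2 - \<bar>dev n x \<omega>\<bar> ^ 3 / m) / (2 * phi x))"
        using True ennreal_divide_mult_half[OF phi_pos[of x]] by simp
      also have "\<dots> \<le> 2 * ennreal (((dev n x \<omega>)\<^sup>2 - \<bar>dev n x \<omega>\<bar> ^ 3 / tail_min x) / (2 * phi x))"
        using m mm phi_pos[of x]
        by (intro mult_left_mono ennreal_leI divide_right_mono diff_left_mono divide_left_mono) auto
      also have "\<dots> \<le> 2 * bregman x (Fn n \<omega> x)"
        using bregman_lower[OF empirical_cdf_bounds[of n \<omega> x], of x]
        by (intro mult_left_mono) (simp_all add: dev_def tail_min_def)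
      finally show ?thesis .
    qed simp
  qed
  also have "\<dots> = 2 * bregman_int n \<omega>" unfolding bregman_int_def using bm by (rule nn_integral_cmult)
  finally show ?thesis .
qed

lemma finite_measure_M: "finite_measure M"
  by (rule finite_measure_axioms)

lemma measurable_dev_weight: "(\<lambda>z. dev n (snd z) (fst z)) \<in> borel_measurable (M \<Otimes>\<^sub>M weight s)"
  using measurable_dev by (simp cong: measurable_cong_sets sets_pair_measure_cong)

text \<open>The second moment is a double weighted integral of mixed fourth moments. The product of
  variances integrates to the square of \<open>var_integral s\<close>, the term 2 * c x y to at most
  2 * 8 = 16 times \<open>var_integral s\<close>, and the remainder 1 / n^3 is multiplied by the
  squared total weight.\<close>

lemma sq_dev_moments:
  assumes n: "1 \<le> n" and s: "0 \<le> s"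
  shows "integrable M (sq_dev n s)" and "expectation (sq_dev n s) = var_integral s / n"
    and "integrable M (\<lambda>\<omega>. (sq_dev n s \<omega>)\<^sup>2)"
    and "expectation (\<lambda>\<omega>. (sq_dev n s \<omega>)\<^sup>2) \<le> ((var_integral s)\<^sup>2 + 16 * var_integral s + (2 * s / phi s)\<^sup>2 / n) / (real n)\<^sup>2"
proof -
  note FM = finite_measure_M
  note FW = finite_measure_weight[OF s]
  interpret W: finite_measure "weight s" by (rule FW)
  note mG [measurable] = measurable_dev_weight
  have m1: "(\<lambda>z. (dev n (snd z) (fst z))\<^sup>2) \<in> borel_measurable (M \<Otimes>\<^sub>M weight s)" by measurable
  note F1 = Fubini_bounded[where f="\<lambda>\<omega> x. (dev n x \<omega>)\<^sup>2", OF FM FW m1 dev_power_le_1(1)]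
  show "integrable M (sq_dev n s)" using F1(1) by (simp add: sq_dev_def[abs_def])
  show "expectation (sq_dev n s) = var_integral s / n"
    unfolding sq_dev_def[abs_def] F1(3) var_integral_def by (simp add: dev_moments[OF n])
  have b: "\<bar>(dev n x \<omega>)\<^sup>2 * (dev n y \<omega>)\<^sup>2\<bar> \<le> 1" for x y \<omega>
    using dev_power_le_1(1)[of n x \<omega>] dev_power_le_1(1)[of n y \<omega>] unfolding abs_mult by (intro mult_le_one) auto
  have Lb: "\<bar>sq_dev n s \<omega>\<bar> \<le> measure (weight s) UNIV" for \<omega>
  proof -
    have "sq_dev n s \<omega> \<le> (\<integral>x. 1 \<partial>weight s)"
      unfolding sq_dev_def using integrable_weight_dev(1)[OF n s] dev_power_le_1(1)[of n _ \<omega>]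
      by (intro integral_mono) (auto simp: W.integrable_const)
    then show ?thesis using sq_dev_nonneg[of n s \<omega>] by simp
  qed
  have Lm [measurable]: "sq_dev n s \<in> borel_measurable M" using \<open>integrable M (sq_dev n s)\<close> by simp
  have bL: "\<bar>(dev n x \<omega>)\<^sup>2 * sq_dev n s \<omega>\<bar> \<le> 1 * measure (weight s) UNIV" for x \<omega>
    using dev_power_le_1(1)[of n x \<omega>] Lb[of \<omega>] unfolding abs_mult by (intro mult_mono) auto
  have m2: "(\<lambda>z. (dev n (snd z) (fst z))\<^sup>2 * sq_dev n s (fst z)) \<in> borel_measurable (M \<Otimes>\<^sub>M weight s)" by measurable
  note F2 = Fubini_bounded[where f="\<lambda>\<omega> x. (dev n x \<omega>)\<^sup>2 * sq_dev n s \<omega>", OF FM FW m2 bL]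
  \<comment> \<open>Keeping one factor of the square as a function of \<omega> produces the double
    integral by two successive exchanges, each on a product with M.\<close>
  have L2: "(\<integral>x. (dev n x \<omega>)\<^sup>2 * sq_dev n s \<omega> \<partial>weight s) = (sq_dev n s \<omega>)\<^sup>2" for \<omega>
    by (simp add: sq_dev_def power2_eq_square)
  show "integrable M (\<lambda>\<omega>. (sq_dev n s \<omega>)\<^sup>2)" using F2(1) unfolding L2 .
  have m3: "(\<lambda>z. (dev n x (fst z))\<^sup>2 * (dev n (snd z) (fst z))\<^sup>2) \<in> borel_measurable (M \<Otimes>\<^sub>M weight s)" for x
    using measurable_dev1[of n x] by measurable
  note F3 = Fubini_bounded[where f="\<lambda>\<omega> y. (dev n x \<omega>)\<^sup>2 * (dev n y \<omega>)\<^sup>2" for x, OF FM FW m3 b]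
  define v where "v x = Phi x * (1 - Phi x)" for x
  define c where "c x y = (Phi (min x y) - Phi x * Phi y)\<^sup>2" for x y
  have c1: "\<bar>c x y\<bar> \<le> 1" for x y
  proof -
    have "0 < Phi x * Phi y" "Phi x * Phi y \<le> 1"
      using Phi_pos[of x] Phi_pos[of y] Phi_less_1[of x] Phi_less_1[of y] by (auto simp: less_imp_le mult_le_one)
    then have "Phi (min x y) - Phi x * Phi y \<le> 1" "- 1 \<le> Phi (min x y) - Phi x * Phi y"
      using Phi_pos[of "min x y"] Phi_less_1[of "min x y"] by linarith+
    then show ?thesis unfolding c_def by (simp add: abs_square_le_1 abs_le_iff)
  qed
  have cm: "(\<lambda>z. c (fst z) (snd z)) \<in> borel_measurable (weight s \<Otimes>\<^sub>M weight s)"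
    unfolding c_def by measurable
  note FC = Fubini_bounded[OF FW FW cm c1]
  have iv: "integrable (weight s) v" unfolding v_def by (intro integrable_weight[OF s _ abs_var_le_1]) measurable
  have ic: "integrable (weight s) (c x)" for x
    by (rule integrable_weight[OF s _ c1]) (simp add: c_def)
  define V where "V = measure (weight s) UNIV"
  have V: "0 \<le> V" "V \<le> 2 * s / phi s" using measure_weight_UNIV[OF s] by (auto simp: V_def)
  have J: "(\<integral>x. v x \<partial>weight s) = var_integral s" by (simp add: v_def var_integral_def)
  have inner: "(\<integral>\<omega>. (dev n x \<omega>)\<^sup>2 * sq_dev n s \<omega> \<partial>M)
     \<le> (v x * var_integral s + 2 * (\<integral>y. c x y \<partial>weight s)) / (real n)\<^sup>2 + V / real n ^ 3" for x
  proof -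
    have "(\<integral>\<omega>. (dev n x \<omega>)\<^sup>2 * sq_dev n s \<omega> \<partial>M) = (\<integral>\<omega>. (\<integral>y. (dev n x \<omega>)\<^sup>2 * (dev n y \<omega>)\<^sup>2 \<partial>weight s) \<partial>M)"
      by (simp add: sq_dev_def)
    also have "\<dots> = (\<integral>y. (\<integral>\<omega>. (dev n x \<omega>)\<^sup>2 * (dev n y \<omega>)\<^sup>2 \<partial>M) \<partial>weight s)" by (rule F3(3))
    also have "\<dots> \<le> (\<integral>y. (v x * v y + 2 * c x y) / (real n)\<^sup>2 + 1 / real n ^ 3 \<partial>weight s)"
      using F3(2) dev_moments(3)[OF n] iv ic unfolding v_def c_def by (intro integral_mono) auto
    also have "\<dots> = (v x * var_integral s + 2 * (\<integral>y. c x y \<partial>weight s)) / (real n)\<^sup>2 + V / real n ^ 3"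
      using iv ic by (simp add: J V_def add_divide_distrib)
    finally show ?thesis .
  qed
  have "expectation (\<lambda>\<omega>. (sq_dev n s \<omega>)\<^sup>2) = (\<integral>x. (\<integral>\<omega>. (dev n x \<omega>)\<^sup>2 * sq_dev n s \<omega> \<partial>M) \<partial>weight s)"
    using F2(3) unfolding L2 .
  also have "\<dots> \<le> (\<integral>x. (v x * var_integral s + 2 * (\<integral>y. c x y \<partial>weight s)) / (real n)\<^sup>2 + V / real n ^ 3 \<partial>weight s)"
    using F2(2) inner iv FC(1) by (intro integral_mono) auto
  also have "\<dots> = (var_integral s * var_integral s + 2 * (\<integral>x. (\<integral>y. c x y \<partial>weight s) \<partial>weight s)) / (real n)\<^sup>2 + V * (V / real n ^ 3)"
    using iv FC(1) by (simp add: J V_def add_divide_distrib)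
  also have "\<dots> \<le> (var_integral s * var_integral s + 2 * (8 * var_integral s)) / (real n)\<^sup>2 + (2 * s / phi s) * ((2 * s / phi s) / real n ^ 3)"
  proof (intro add_mono divide_right_mono add_left_mono mult_left_mono mult_mono)
    show "(\<integral>x. (\<integral>y. c x y \<partial>weight s) \<partial>weight s) \<le> 8 * var_integral s"
      unfolding c_def by (rule cov_sq_integral_le[OF s])
  qed (use V s phi_pos[of s] var_integral_nonneg[of s] in auto)
  also have "\<dots> = ((var_integral s)\<^sup>2 + 16 * var_integral s + (2 * s / phi s)\<^sup>2 / n) / (real n)\<^sup>2"
    using n by (simp add: add_divide_distrib power2_eq_square power3_eq_cube)
  finally show "expectation (\<lambda>\<omega>. (sq_dev n s \<omega>)\<^sup>2) \<le> ((var_integral s)\<^sup>2 + 16 * var_integral s + (2 * s / phi s)\<^sup>2 / n) / (real n)\<^sup>2" .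
qed

lemma cube_dev_expectation:
  assumes n: "1 \<le> n" and s: "0 \<le> s"
  shows "integrable M (cube_dev n s)" and "real n * expectation (cube_dev n s) \<le> 4 * s / (phi s * sqrt n * (1 - Phi s))"
proof -
  interpret W: finite_measure "weight s" by (rule finite_measure_weight[OF s])
  note [measurable] = measurable_dev_weight
  have m1: "(\<lambda>z. \<bar>dev n (snd z) (fst z)\<bar> ^ 3) \<in> borel_measurable (M \<Otimes>\<^sub>M weight s)" by measurable
  note F1 = Fubini_bounded[where f="\<lambda>\<omega> x. \<bar>dev n x \<omega>\<bar> ^ 3", OF finite_measure_M finite_measure_weight[OF s] m1 dev_power_le_1(2)]
  show "integrable M (cube_dev n s)" using F1(1) by (simp add: cube_dev_def[abs_def])
  have n0: "0 < real n" using n by simp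
  have "(\<integral>x. expectation (\<lambda>\<omega>. \<bar>dev n x \<omega>\<bar> ^ 3) \<partial>weight s) \<le> (\<integral>x. 2 / (n * sqrt n) \<partial>weight s)"
    using F1(2) dev_third_moment[OF n] by (intro integral_mono) auto
  also have "\<dots> = measure (weight s) UNIV * (2 / (n * sqrt n))" by simp
  also have "\<dots> \<le> (2 * s / phi s) * (2 / (n * sqrt n))"
    using measure_weight_UNIV[OF s] by (intro mult_right_mono) auto
  finally have "real n * ((\<integral>x. expectation (\<lambda>\<omega>. \<bar>dev n x \<omega>\<bar> ^ 3) \<partial>weight s) / (1 - Phi s))
      \<le> real n * ((2 * s / phi s) * (2 / (n * sqrt n)) / (1 - Phi s))"
    using Phi_less_1[of s] by (intro mult_left_mono divide_right_mono) auto
  also have "\<dots> = 4 * s / (phi s * sqrt n * (1 - Phi s))"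
    using n0 by simp
  finally show "real n * expectation (cube_dev n s) \<le> 4 * s / (phi s * sqrt n * (1 - Phi s))"
    unfolding cube_dev_def[abs_def] by (simp add: F1(3))
qed

end

text \<open>n times the cubic error on the window, after inserting the third moment and the total
  weight; it enters both the upper and the lower estimate.\<close>

definition cube_dev_bound :: "nat \<Rightarrow> real \<Rightarrow> real" where
  "cube_dev_bound n s = 4 * s / (phi s * sqrt n * (1 - Phi s))"

section \<open>Bounds for the first two moments of the Wasserstein distance at fixed n\<close>

context iid_std_normal begin

text \<open>The upper bound comes first because it also yields the almost sure finiteness that the
  lower bounds need.\<close>

lemma expectation_W2_sq_bounds:
  assumes n: "1 \<le> n" and s: "0 < s" and r: "s \<le> r"
  shows "integrable M (\<lambda>\<omega>. (W2 (Fn n \<omega>) Phi)\<^sup>2)"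
    and "real n * expectation (\<lambda>\<omega>. (W2 (Fn n \<omega>) Phi)\<^sup>2)
       \<le> var_integral s + cube_dev_bound n s + 4 * r / s + 4 * real n * (1 - Phi r)"
    and "var_integral s - cube_dev_bound n s \<le> real n * expectation (\<lambda>\<omega>. (W2 (Fn n \<omega>) Phi)\<^sup>2)"
    and "AE \<omega> in M. sq_dev n s \<omega> - cube_dev n s \<omega> \<le> (W2 (Fn n \<omega>) Phi)\<^sup>2"
proof -
  let ?B = "var_integral s + cube_dev_bound n s + 4 * r / s + 4 * real n * (1 - Phi r)"
  have n0: "0 < real n" using n by simp
  have s0: "0 \<le> s" using s by simp
  have cube_dev_bound: "0 \<le> cube_dev_bound n s" using s phi_pos[of s] Phi_less_1[of s] by (simp add: cube_dev_bound_def)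
  have B: "0 \<le> ?B" using cube_dev_bound var_integral_nonneg[of s] s r Phi_less_1[of r] by simp
  have up: "(\<integral>\<^sup>+\<omega>. 2 * bregman_int n \<omega> \<partial>M) \<le> ennreal (?B / n)"
    using expectation_bregman_int_upper[OF n s r] by (simp add: cube_dev_bound_def)
  then have "(\<integral>\<^sup>+\<omega>. 2 * bregman_int n \<omega> \<partial>M) \<noteq> \<infinity>"
    by (auto simp: top_unique)
  \<comment> \<open>Where the integral is infinite, \<open>enn2real\<close> would report W2 = 0 and
    the lower bound could fail; this happens only on a null set.\<close>
  then have fin: "AE \<omega> in M. 2 * bregman_int n \<omega> \<noteq> \<infinity>"
    by (intro nn_integral_noteq_infinite) auto
  have eq: "AE \<omega> in M. ennreal ((W2 (Fn n \<omega>) Phi)\<^sup>2) = 2 * bregman_int n \<omega>"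
    using fin by eventually_elim (simp add: W2_sq_Fn[OF n] less_top)
  have Wm: "(\<lambda>\<omega>. (W2 (Fn n \<omega>) Phi)\<^sup>2) \<in> borel_measurable M"
    using measurable_W2[OF n] by measurable
  have nn: "(\<integral>\<^sup>+\<omega>. ennreal ((W2 (Fn n \<omega>) Phi)\<^sup>2) \<partial>M) \<le> ennreal (?B / n)"
    using nn_integral_cong_AE[OF eq] up by simp
  show int: "integrable M (\<lambda>\<omega>. (W2 (Fn n \<omega>) Phi)\<^sup>2)"
    using nn Wm by (intro integrableI_nonneg) (auto simp: le_less_trans[OF _ ennreal_less_top])
  have "ennreal (expectation (\<lambda>\<omega>. (W2 (Fn n \<omega>) Phi)\<^sup>2)) \<le> ennreal (?B / n)"
    using nn nn_integral_eq_integral[OF int] by simp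
  then have "expectation (\<lambda>\<omega>. (W2 (Fn n \<omega>) Phi)\<^sup>2) \<le> ?B / n"
    using B n0 by (subst (asm) ennreal_le_iff) auto
  then show "real n * expectation (\<lambda>\<omega>. (W2 (Fn n \<omega>) Phi)\<^sup>2) \<le> ?B"
    using n0 by (simp add: pos_le_divide_eq mult.commute)
  show ae: "AE \<omega> in M. sq_dev n s \<omega> - cube_dev n s \<omega> \<le> (W2 (Fn n \<omega>) Phi)\<^sup>2"
    using eq
  proof eventually_elim
    case (elim \<omega>)
    then have "ennreal (sq_dev n s \<omega> - cube_dev n s \<omega>) \<le> ennreal ((W2 (Fn n \<omega>) Phi)\<^sup>2)"
      using bregman_int_lower[OF n s0, of \<omega>] by simp
    then show ?case by (simp add: ennreal_le_iff)
  qed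
  have "expectation (\<lambda>\<omega>. sq_dev n s \<omega> - cube_dev n s \<omega>) \<le> expectation (\<lambda>\<omega>. (W2 (Fn n \<omega>) Phi)\<^sup>2)"
    using ae int sq_dev_moments(1)[OF n s0] cube_dev_expectation(1)[OF n s0] by (intro integral_mono_AE) auto
  then have "var_integral s / n - expectation (cube_dev n s) \<le> expectation (\<lambda>\<omega>. (W2 (Fn n \<omega>) Phi)\<^sup>2)"
    using sq_dev_moments(1,2)[OF n s0] cube_dev_expectation(1)[OF n s0] by simp
  then have "real n * (var_integral s / n - expectation (cube_dev n s)) \<le> real n * expectation (\<lambda>\<omega>. (W2 (Fn n \<omega>) Phi)\<^sup>2)"
    by (intro mult_left_mono) auto
  then show "var_integral s - cube_dev_bound n s \<le> real n * expectation (\<lambda>\<omega>. (W2 (Fn n \<omega>) Phi)\<^sup>2)"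
    using cube_dev_expectation(2)[OF n s0] n0 by (simp add: right_diff_distrib cube_dev_bound_def)
qed

text \<open>The first part is nonnegativity of the variance. For the second, the quadratic minorant
  is taken at a = J, the mean of n * sq_dev, where it touches the square root to first order; its
  expectation involves only the two known moments, and 3 - (1 + 16 / J + ...) is halved.\<close>

lemma expectation_W2_bounds:
  assumes n: "1 \<le> n" and s: "0 < s" and J: "0 < var_integral s"
  shows "(expectation (\<lambda>\<omega>. W2 (Fn n \<omega>) Phi))\<^sup>2 \<le> expectation (\<lambda>\<omega>. (W2 (Fn n \<omega>) Phi)\<^sup>2)"
    and "sqrt (var_integral s) * (1 - 8 / var_integral s - (2 * s / phi s)\<^sup>2 / n / (var_integral s)\<^sup>2 / 2) - 1 - cube_dev_bound n s
      \<le> sqrt n * expectation (\<lambda>\<omega>. W2 (Fn n \<omega>) Phi)"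
proof -
  define W where "W \<omega> = W2 (Fn n \<omega>) Phi" for \<omega>
  define J where "J = var_integral s"
  have n0: "0 < real n" using n by simp
  have s0: "0 \<le> s" using s by simp
  note b = expectation_W2_sq_bounds[OF n s order.refl]
  have iW2: "integrable M (\<lambda>\<omega>. (W \<omega>)\<^sup>2)" using b(1) by (simp add: W_def)
  have Wm: "W \<in> borel_measurable M" using measurable_W2[OF n] by (simp add: W_def[abs_def])
  have W0: "0 \<le> W \<omega>" for \<omega> by (simp add: W_def W2_Fn_nonneg)
  have iW: "integrable M W"
    by (rule square_integrable_imp_integrable[OF Wm iW2])
  have "0 \<le> variance W" by (rule variance_positive)
  then have "(expectation W)\<^sup>2 \<le> expectation (\<lambda>\<omega>. (W \<omega>)\<^sup>2)"
    by (simp add: variance_eq[OF iW iW2])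
  then show "(expectation (\<lambda>\<omega>. W2 (Fn n \<omega>) Phi))\<^sup>2 \<le> expectation (\<lambda>\<omega>. (W2 (Fn n \<omega>) Phi)\<^sup>2)"
    by (simp add: W_def[abs_def])
  have J0: "0 < J" using J by (simp add: J_def)
  have iL: "integrable M (sq_dev n s)" "integrable M (\<lambda>\<omega>. (sq_dev n s \<omega>)\<^sup>2)" "integrable M (cube_dev n s)"
    using sq_dev_moments[OF n s0] cube_dev_expectation[OF n s0] by auto
  have "AE \<omega> in M. sqrt J / 2 * (3 * (n * sq_dev n s \<omega> / J) - (n * sq_dev n s \<omega> / J)\<^sup>2) \<le> sqrt n * W \<omega> + 1 + n * cube_dev n s \<omega>"
    using b(4)
  proof eventually_elim
    case (elim \<omega>)
    have R0: "0 \<le> n * cube_dev n s \<omega>" using cube_dev_nonneg[of n s \<omega>] by simp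
    have "n * sq_dev n s \<omega> \<le> n * (W \<omega>)\<^sup>2 + n * cube_dev n s \<omega>"
      using elim mult_left_mono[of "sq_dev n s \<omega> - cube_dev n s \<omega>" "(W \<omega>)\<^sup>2" "real n"] by (simp add: W_def right_diff_distrib)
    then have "sqrt (n * sq_dev n s \<omega>) \<le> sqrt (n * (W \<omega>)\<^sup>2 + n * cube_dev n s \<omega>)" by simp
    also have "\<dots> \<le> sqrt (n * (W \<omega>)\<^sup>2) + sqrt (n * cube_dev n s \<omega>)"
      using R0 by (intro sqrt_add_le_add_sqrt) auto
    also have "sqrt (n * (W \<omega>)\<^sup>2) = sqrt n * W \<omega>" using W0[of \<omega>] by (simp add: real_sqrt_mult)
    \<comment> \<open>The crude bound sqrt z \<le> 1 + z reduces the remainder to its first moment;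
      the additive 1 disappears on division by sqrt (ln (ln n)).\<close>
    also have "sqrt (n * cube_dev n s \<omega>) \<le> 1 + n * cube_dev n s \<omega>"
      using R0 by (intro real_le_lsqrt) (auto simp: power2_eq_square algebra_simps)
    finally have "sqrt (n * sq_dev n s \<omega>) \<le> sqrt n * W \<omega> + 1 + n * cube_dev n s \<omega>" by simp
    then show ?case
      using sqrt_lower_quadratic[OF J0, of "n * sq_dev n s \<omega>"] sq_dev_nonneg[of n s \<omega>] by simp
  qed
  then have "expectation (\<lambda>\<omega>. sqrt J / 2 * (3 * (n * sq_dev n s \<omega> / J) - (n * sq_dev n s \<omega> / J)\<^sup>2))
      \<le> expectation (\<lambda>\<omega>. sqrt n * W \<omega> + 1 + n * cube_dev n s \<omega>)"
    using iL iW by (intro integral_mono_AE) (auto simp: power_mult_distrib power_divide)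
  also have "expectation (\<lambda>\<omega>. sqrt n * W \<omega> + 1 + n * cube_dev n s \<omega>) = sqrt n * expectation W + 1 + n * expectation (cube_dev n s)"
    using iL iW by (simp add: prob_space)
  also have "expectation (\<lambda>\<omega>. sqrt J / 2 * (3 * (n * sq_dev n s \<omega> / J) - (n * sq_dev n s \<omega> / J)\<^sup>2))
      = sqrt J / 2 * (3 * (n * expectation (sq_dev n s) / J) - (real n)\<^sup>2 * expectation (\<lambda>\<omega>. (sq_dev n s \<omega>)\<^sup>2) / J\<^sup>2)"
    using iL by (simp add: power_mult_distrib power_divide)
  also have "n * expectation (sq_dev n s) / J = 1"
    using sq_dev_moments(2)[OF n s0] J0 n0 by (simp add: J_def)
  finally have main: "sqrt J / 2 * (3 * 1 - (real n)\<^sup>2 * expectation (\<lambda>\<omega>. (sq_dev n s \<omega>)\<^sup>2) / J\<^sup>2)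
      \<le> sqrt n * expectation W + 1 + n * expectation (cube_dev n s)" .
  have "(real n)\<^sup>2 * expectation (\<lambda>\<omega>. (sq_dev n s \<omega>)\<^sup>2) / J\<^sup>2 \<le> 1 + 16 / J + (2 * s / phi s)\<^sup>2 / n / J\<^sup>2"
  proof -
    have "(real n)\<^sup>2 * expectation (\<lambda>\<omega>. (sq_dev n s \<omega>)\<^sup>2) \<le> (real n)\<^sup>2 * ((J\<^sup>2 + 16 * J + (2 * s / phi s)\<^sup>2 / n) / (real n)\<^sup>2)"
      using sq_dev_moments(4)[OF n s0] unfolding J_def by (intro mult_left_mono) auto
    also have "\<dots> = J\<^sup>2 + 16 * J + (2 * s / phi s)\<^sup>2 / n"
      using n0 by simp
    finally have "(real n)\<^sup>2 * expectation (\<lambda>\<omega>. (sq_dev n s \<omega>)\<^sup>2) / J\<^sup>2 \<le> (J\<^sup>2 + 16 * J + (2 * s / phi s)\<^sup>2 / n) / J\<^sup>2"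
      by (intro divide_right_mono) auto
    also have "\<dots> = 1 + 16 / J + (2 * s / phi s)\<^sup>2 / n / J\<^sup>2"
      using J0 by (simp add: add_divide_distrib power2_eq_square)
    finally show ?thesis .
  qed
  then have "sqrt J / 2 * (3 * 1 - (1 + 16 / J + (2 * s / phi s)\<^sup>2 / n / J\<^sup>2)) \<le> sqrt J / 2 * (3 * 1 - (real n)\<^sup>2 * expectation (\<lambda>\<omega>. (sq_dev n s \<omega>)\<^sup>2) / J\<^sup>2)"
    using J0 by (intro mult_left_mono) auto
  also note main
  also have "n * expectation (cube_dev n s) \<le> cube_dev_bound n s"
    using cube_dev_expectation(2)[OF n s0] by (simp add: cube_dev_bound_def)
  finally have "sqrt J / 2 * (3 * 1 - (1 + 16 / J + (2 * s / phi s)\<^sup>2 / n / J\<^sup>2)) - 1 - cube_dev_bound n s \<le> sqrt n * expectation W"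
    by (simp only: diff_le_eq ac_simps)
  moreover have "sqrt J / 2 * (3 * 1 - (1 + 16 / J + (2 * s / phi s)\<^sup>2 / n / J\<^sup>2)) = sqrt J * (1 - 8 / J - (2 * s / phi s)\<^sup>2 / n / J\<^sup>2 / 2)"
    by (simp add: field_simps)
  ultimately have "sqrt J * (1 - 8 / J - (2 * s / phi s)\<^sup>2 / n / J\<^sup>2 / 2) - 1 - cube_dev_bound n s \<le> sqrt n * expectation W"
    by (simp only:)
  then show "sqrt (var_integral s) * (1 - 8 / var_integral s - (2 * s / phi s)\<^sup>2 / n / (var_integral s)\<^sup>2 / 2) - 1 - cube_dev_bound n s
      \<le> sqrt n * expectation (\<lambda>\<omega>. W2 (Fn n \<omega>) Phi)"
    unfolding J_def W_def .
qed

end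

text \<open>The mass of the unit interval after s is at least its smallest density. At the cutoff
  this loses only a factor exp (O(sqrt (ln n))), below any power of n, and leaves a closed form for
  the asymptotics.\<close>

lemma phi_succ_le_tail: "phi (s + 1) \<le> 1 - Phi s" if "0 \<le> s"
proof -
  obtain z where z: "s < z" "z < s + 1" "Phi (s + 1) - Phi s = (s + 1 - s) * phi z"
    using MVT2[of s "s + 1" Phi phi] DERIV_Phi by auto
  have "phi (s + 1) \<le> phi z" using z that by (intro phi_mono_abs) auto
  then show ?thesis using z Phi_less_1[of "s + 1"] by simp
qed

section \<open>Asymptotics\<close>

text \<open>The cubic error is governed by 1 / (phi s * (1 - Phi s)), about exp (s^2) up to powers
  of s. The constant 1 / 2 makes this n powr (1 / 4), safely below the available sqrt n.\<close>

definition cutoff :: "nat \<Rightarrow> real" where "cutoff n = sqrt (ln n) / 2"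

lemma cutoff_at_top: "filterlim cutoff at_top sequentially"
  unfolding cutoff_def[abs_def] by real_asymp

text \<open>With t = sqrt (ln n), the product phi (t / 2) * phi (t / 2 + 1) has exponent - (t^2 / 4
  + t / 2 + 1 / 2), so the majorant is n powr (- 1 / 4) up to subpolynomial factors.\<close>

lemma cube_dev_bound_cutoff_tendsto_0: "(\<lambda>n. cube_dev_bound n (cutoff n)) \<longlonglongrightarrow> 0"
proof (rule tendsto_sandwich)
  show "\<forall>\<^sub>F n in sequentially. 0 \<le> cube_dev_bound n (cutoff n)"
    using eventually_ge_at_top[of 1]
    by eventually_elim
      (auto simp: cube_dev_bound_def cutoff_def less_imp_le[OF phi_pos] less_imp_le[OF Phi_less_1] intro!: divide_nonneg_nonneg mult_nonneg_nonneg)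
  show "\<forall>\<^sub>F n in sequentially. cube_dev_bound n (cutoff n) \<le> 4 * cutoff n / (phi (cutoff n) * sqrt n * phi (cutoff n + 1))"
    using eventually_gt_at_top[of 0]
  proof eventually_elim
    case (elim n)
    then show ?case
      using phi_pos[of "cutoff n"] phi_pos[of "cutoff n + 1"] phi_succ_le_tail[of "cutoff n"] Phi_less_1[of "cutoff n"]
      unfolding cube_dev_bound_def by (intro divide_left_mono mult_left_mono mult_pos_pos) (auto simp: cutoff_def)
  qed
  have "4 * pi * sqrt (ln n) * exp (ln n / 4 + sqrt (ln n) / 2 + 1 / 2) / sqrt n
      = 4 * cutoff n / (phi (cutoff n) * sqrt n * phi (cutoff n + 1))" if "1 \<le> n" for n :: nat
  proof -
    define t where "t = sqrt (ln n)"
    have t: "ln n = t\<^sup>2" "0 \<le> t" using that by (simp_all add: t_def)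
    have "phi (t / 2) * phi (t / 2 + 1) = 1 / (2 * pi) * (exp (- (t / 2)\<^sup>2 / 2) * exp (- (t / 2 + 1)\<^sup>2 / 2))"
      by (simp add: std_normal_density_def)
    also have "exp (- (t / 2)\<^sup>2 / 2) * exp (- (t / 2 + 1)\<^sup>2 / 2) = exp (- (t\<^sup>2 / 4 + t / 2 + 1 / 2))"
      unfolding exp_add[symmetric] by (simp add: power2_eq_square field_simps)
    finally have "phi (t / 2) * phi (t / 2 + 1) = 1 / (2 * pi * exp (t\<^sup>2 / 4 + t / 2 + 1 / 2))"
      by (simp add: exp_minus field_simps)
    moreover have "4 * (t / 2) / (phi (t / 2) * sqrt n * phi (t / 2 + 1)) = 2 * t / (phi (t / 2) * phi (t / 2 + 1)) / sqrt n"
      by (simp add: mult_ac)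
    ultimately have "4 * (t / 2) / (phi (t / 2) * sqrt n * phi (t / 2 + 1)) = 4 * pi * t * exp (t\<^sup>2 / 4 + t / 2 + 1 / 2) / sqrt n"
      by simp
    then show ?thesis using t(2) unfolding cutoff_def t(1) by simp
  qed
  then have "\<forall>\<^sub>F n in sequentially. 4 * pi * sqrt (ln n) * exp (ln n / 4 + sqrt (ln n) / 2 + 1 / 2) / sqrt n
      = 4 * cutoff n / (phi (cutoff n) * sqrt n * phi (cutoff n + 1))"
    by (rule eventually_sequentiallyI)
  moreover have "(\<lambda>n::nat. 4 * pi * sqrt (ln n) * exp (ln n / 4 + sqrt (ln n) / 2 + 1 / 2) / sqrt n) \<longlonglongrightarrow> 0"
    by real_asymp
  ultimately show "(\<lambda>n. 4 * cutoff n / (phi (cutoff n) * sqrt n * phi (cutoff n + 1))) \<longlonglongrightarrow> 0"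
    by (rule Lim_transform_eventually[rotated])
qed simp

text \<open>2 * ln (cutoff n) = ln (ln n) - 2 * ln 2, so the constant in the cutoff does not reach
  the limit.\<close>

lemma var_integral_cutoff_asymp: "(\<lambda>n. var_integral (cutoff n) / ln (ln n)) \<longlonglongrightarrow> 1"
proof -
  have "(\<lambda>n. var_integral (cutoff n) / (2 * ln (cutoff n))) \<longlonglongrightarrow> 1"
    by (rule filterlim_compose[OF var_integral_asymp cutoff_at_top])
  moreover have "(\<lambda>n. 2 * ln (cutoff n) / ln (ln n)) \<longlonglongrightarrow> 1"
    unfolding cutoff_def by real_asymp
  ultimately have "(\<lambda>n. var_integral (cutoff n) / (2 * ln (cutoff n)) * (2 * ln (cutoff n) / ln (ln n))) \<longlonglongrightarrow> 1 * 1"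
    by (rule tendsto_mult)
  moreover have "\<forall>\<^sub>F n in sequentially. 0 < ln (cutoff n)"
    unfolding cutoff_def by real_asymp
  then have "\<forall>\<^sub>F n in sequentially. var_integral (cutoff n) / (2 * ln (cutoff n)) * (2 * ln (cutoff n) / ln (ln n)) = var_integral (cutoff n) / ln (ln n)"
    by eventually_elim simp
  ultimately show ?thesis by (simp add: Lim_transform_eventually)
qed

theorem theorem1:
  fixes M :: "'a measure" and X :: "nat \<Rightarrow> 'a \<Rightarrow> real"
  assumes "prob_space M"
    and "prob_space.indep_vars M (\<lambda>_. borel) X {1..}"
    and "\<And>i. i \<ge> 1 \<Longrightarrow> distributed M lborel (X i) std_normal_density"
  shows "((\<lambda>n::nat. real n / ln (ln (real n)) *
            prob_space.expectation M (\<lambda>\<omega>. (W2 (empirical_cdf X n \<omega>) std_normal_cdf)\<^sup>2))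
          \<longlonglongrightarrow> 1) \<and>
         ((\<lambda>n::nat. sqrt (real n / ln (ln (real n))) *
            prob_space.expectation M (\<lambda>\<omega>. W2 (empirical_cdf X n \<omega>) std_normal_cdf))
          \<longlonglongrightarrow> 1)"
proof -
  interpret iid_std_normal M X
    using assms by (simp add: iid_std_normal_def iid_std_normal_axioms_def)
  define E2 where "E2 n = expectation (\<lambda>\<omega>. (W2 (Fn n \<omega>) Phi)\<^sup>2)" for n
  define E1 where "E1 n = expectation (\<lambda>\<omega>. W2 (Fn n \<omega>) Phi)" for n
  define J where "J n = var_integral (cutoff n)" for n
  define e where "e n = cube_dev_bound n (cutoff n)" for n
  \<comment> \<open>Chosen so that phi (r n) = 1 / (n * sqrt (2 * pi)): the outer tails, multiplied
    by n, stay bounded.\<close>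
  define r where "r n = sqrt (2 * ln n)" for n :: nat
  define V where "V n = (2 * cutoff n / phi (cutoff n))\<^sup>2 / n" for n :: nat
  note Jl = var_integral_cutoff_asymp[folded J_def]
  note el = cube_dev_bound_cutoff_tendsto_0[folded e_def]
  have ll: "filterlim (\<lambda>n::nat. ln (ln n)) at_top sequentially" by real_asymp
  have ev: "\<forall>\<^sub>F n in sequentially. 1 \<le> n \<and> 0 < cutoff n \<and> 0 < ln (ln (real n)) \<and> cutoff n \<le> r n \<and> 1 \<le> r n \<and> 0 < J n"
  proof -
    have "\<forall>\<^sub>F n in sequentially. 0 < J n / ln (ln n)"
      by (rule order_tendstoD(1)[OF Jl]) simp
    moreover have "\<forall>\<^sub>F n in sequentially. 0 < ln (ln (real n))" by real_asymp
    moreover have "\<forall>\<^sub>F n in sequentially. 0 < cutoff n" unfolding cutoff_def by real_asymp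
    moreover have "\<forall>\<^sub>F n in sequentially. cutoff n \<le> r n"
      using eventually_ge_at_top[of 1]
    proof eventually_elim
      case (elim n)
      then have "sqrt (ln n) \<le> r n" "0 \<le> sqrt (ln n)" by (auto simp: r_def)
      then show ?case unfolding cutoff_def by linarith
    qed
    moreover have "\<forall>\<^sub>F n in sequentially. 1 \<le> r n" unfolding r_def by real_asymp
    ultimately show ?thesis
      using eventually_ge_at_top[of 1] by eventually_elim (auto simp: zero_less_divide_iff)
  qed
  have tail: "real n * (1 - Phi (r n)) \<le> 1" if "1 \<le> n" "1 \<le> r n" for n
  proof -
    have "1 - Phi (r n) \<le> r n * (1 - Phi (r n))" using that Phi_less_1[of "r n"] by simp
    also have "\<dots> \<le> phi (r n)" by (rule mills_upper)
    also have "phi (r n) = 1 / sqrt (2 * pi) * (1 / n)"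
      using that by (simp add: std_normal_density_def r_def exp_minus inverse_eq_divide)
    also have "\<dots> \<le> 1 * (1 / n)"
      using pi_gt3 by (intro mult_right_mono) auto
    finally show ?thesis using that by (simp add: field_simps)
  qed
  have up: "\<forall>\<^sub>F n in sequentially. real n / ln (ln n) * E2 n \<le> J n / ln (ln n) + (e n + 4 * r n / cutoff n + 4) / ln (ln n)"
    using ev
  proof eventually_elim
    case (elim n)
    then have "real n * E2 n \<le> J n + (e n + 4 * r n / cutoff n + 4)"
      using expectation_W2_sq_bounds(2)[of n "cutoff n" "r n"] tail[of n] by (simp add: E2_def J_def e_def)
    then have "real n * E2 n / ln (ln n) \<le> (J n + (e n + 4 * r n / cutoff n + 4)) / ln (ln n)"
      using elim by (intro divide_right_mono) auto
    then show ?case by (simp add: add_divide_distrib)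
  qed
  have lo: "\<forall>\<^sub>F n in sequentially. J n / ln (ln n) - e n / ln (ln n) \<le> real n / ln (ln n) * E2 n"
    using ev
  proof eventually_elim
    case (elim n)
    then have "J n - e n \<le> real n * E2 n"
      using expectation_W2_sq_bounds(3)[of n "cutoff n" "r n"] by (simp add: E2_def J_def e_def)
    then have "(J n - e n) / ln (ln n) \<le> real n * E2 n / ln (ln n)"
      using elim by (intro divide_right_mono) auto
    then show ?case by (simp add: diff_divide_distrib)
  qed
  \<comment> \<open>The ratio r n / cutoff n is the constant 2 * sqrt 2, so the numerator stays
    bounded.\<close>
  have rl: "(\<lambda>n. (4 * r n / cutoff n + 4) / ln (ln n)) \<longlonglongrightarrow> 0"
    unfolding r_def cutoff_def by real_asymp
  have ed: "(\<lambda>n. e n / ln (ln n)) \<longlonglongrightarrow> 0"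
    by (rule real_tendsto_divide_at_top[OF el ll])
  have lim2: "(\<lambda>n. real n / ln (ln n) * E2 n) \<longlonglongrightarrow> 1"
  proof (rule tendsto_sandwich[OF lo up])
    show "(\<lambda>n. J n / ln (ln n) - e n / ln (ln n)) \<longlonglongrightarrow> 1"
      using tendsto_diff[OF Jl ed] by simp
    show "(\<lambda>n. J n / ln (ln n) + (e n + 4 * r n / cutoff n + 4) / ln (ln n)) \<longlonglongrightarrow> 1"
      using tendsto_add[OF Jl tendsto_add[OF ed rl]] by (simp add: add_divide_distrib add.assoc)
  qed
  \<comment> \<open>The fourth-moment remainder in closed form: it is of order ln n * n powr (- 3 /
    4).\<close>
  have Vn: "V n = 2 * pi * ln n * exp (ln n / 4) / n" if "1 \<le> n" for n
  proof -
    have "2 * cutoff n / phi (cutoff n) = sqrt (ln n) * (sqrt (2 * pi) * exp (ln n / 8))"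
      using that by (simp add: cutoff_def std_normal_density_def power_divide exp_minus field_simps)
    moreover have "(exp (ln n / 8))\<^sup>2 = exp (ln n / 4)"
      by (simp add: power2_eq_square flip: exp_add)
    ultimately show ?thesis
      using that by (simp add: V_def power_mult_distrib)
  qed
  have "\<forall>\<^sub>F n in sequentially. 2 * pi * ln n * exp (ln n / 4) / n = V n"
    using eventually_ge_at_top[of 1] by eventually_elim (rule Vn[symmetric])
  moreover have "(\<lambda>n::nat. 2 * pi * ln n * exp (ln n / 4) / n) \<longlonglongrightarrow> 0" by real_asymp
  ultimately have Vl: "V \<longlonglongrightarrow> 0" by (rule Lim_transform_eventually[rotated])
  have Jtop: "filterlim J at_top sequentially"
  proof -
    have "filterlim (\<lambda>n. J n / ln (ln n) * ln (ln (real n))) at_top sequentially"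
      by (rule filterlim_tendsto_pos_mult_at_top[OF Jl _ ll]) simp
    moreover have "\<forall>\<^sub>F n in sequentially. J n / ln (ln n) * ln (ln (real n)) = J n"
      using ev by eventually_elim simp
    ultimately show ?thesis by (simp cong: filterlim_cong)
  qed
  have lo1: "\<forall>\<^sub>F n in sequentially. sqrt (J n / ln (ln n)) * (1 - 8 / J n - V n / (J n)\<^sup>2 / 2) - (1 + e n) / sqrt (ln (ln n))
      \<le> sqrt (real n / ln (ln n)) * E1 n"
    using ev
  proof eventually_elim
    case (elim n)
    then have "sqrt (J n) * (1 - 8 / J n - V n / (J n)\<^sup>2 / 2) - (1 + e n) \<le> sqrt n * E1 n"
      using expectation_W2_bounds(2)[of n "cutoff n"] by (simp add: E1_def J_def e_def V_def)
    then have "(sqrt (J n) * (1 - 8 / J n - V n / (J n)\<^sup>2 / 2) - (1 + e n)) / sqrt (ln (ln n)) \<le> sqrt n * E1 n / sqrt (ln (ln n))"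
      using elim by (intro divide_right_mono) auto
    then show ?case by (simp add: diff_divide_distrib real_sqrt_divide)
  qed
  \<comment> \<open>Jensen's inequality reduces the upper bound to the limit already proved for the
    squared distance.\<close>
  have up1: "\<forall>\<^sub>F n in sequentially. sqrt (real n / ln (ln n)) * E1 n \<le> sqrt (real n / ln (ln n) * E2 n)"
    using ev
  proof eventually_elim
    case (elim n)
    then have "(E1 n)\<^sup>2 \<le> E2 n"
      using expectation_W2_bounds(1)[of n "cutoff n"] by (simp add: E1_def J_def E2_def)
    then have "E1 n \<le> sqrt (E2 n)" by (rule real_le_rsqrt)
    then have "sqrt (real n / ln (ln n)) * E1 n \<le> sqrt (real n / ln (ln n)) * sqrt (E2 n)"
      using elim by (intro mult_left_mono) auto
    then show ?case by (simp only: real_sqrt_mult)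
  qed
  \<comment> \<open>J tends to infinity, so the relative corrections 8 / J and V / J^2 vanish and
    the bracket tends to 1; the bounded 1 + e vanishes after division by sqrt (ln (ln n)).\<close>
  have lim1: "(\<lambda>n. sqrt (real n / ln (ln n)) * E1 n) \<longlonglongrightarrow> 1"
  proof (rule tendsto_sandwich[OF lo1 up1])
    have a: "(\<lambda>n. sqrt (J n / ln (ln n))) \<longlonglongrightarrow> sqrt 1" by (intro tendsto_intros Jl)
    have b: "(\<lambda>n. 8 / J n) \<longlonglongrightarrow> 0" by (rule real_tendsto_divide_at_top[OF tendsto_const Jtop])
    have "(\<lambda>n. V n / (J n)\<^sup>2) \<longlonglongrightarrow> 0"
      by (rule real_tendsto_divide_at_top[OF Vl filterlim_pow_at_top[OF _ Jtop]]) simp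
    then have c: "(\<lambda>n. V n / (J n)\<^sup>2 / 2) \<longlonglongrightarrow> 0" by (rule tendsto_divide_zero)
    have d: "(\<lambda>n. (1 + e n) / sqrt (ln (ln n))) \<longlonglongrightarrow> 0"
      by (rule real_tendsto_divide_at_top[OF tendsto_add[OF tendsto_const el] filterlim_compose[OF sqrt_at_top ll]])
    show "(\<lambda>n. sqrt (J n / ln (ln n)) * (1 - 8 / J n - V n / (J n)\<^sup>2 / 2) - (1 + e n) / sqrt (ln (ln n))) \<longlonglongrightarrow> 1"
      using tendsto_diff[OF tendsto_mult[OF a tendsto_diff[OF tendsto_diff[OF tendsto_const b] c]] d] by simp
    show "(\<lambda>n. sqrt (real n / ln (ln n) * E2 n)) \<longlonglongrightarrow> 1"
      using tendsto_real_sqrt[OF lim2] by simp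
  qed
  show ?thesis using lim1 lim2 unfolding E1_def E2_def by blast
qed

end
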